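(* Let $d\in\{1,2,3\}$, let $\Omega=\prod_{j=1}^d[0,L_j]\subset\mathbb{R}^d$ be a rectangular domain with volume $|\Omega|$, and let $\alpha,\gamma\in\mathbb{R}$ with $\gamma\ge0$ and $\alpha<1$. For $\phi\in H^2_{\mathrm{per}}(\Omega)$ let $$\mathcal{E}(\phi)=\int_\Omega\Big\{\tfrac12\big(\Delta\phi+\phi\big)^2-\tfrac{\alpha}{2}\phi^2+\tfrac{1}{24}\phi^4-\tfrac{\gamma}{6}\phi^3\Big\}\,\mathrm{d}\boldsymbol{x}.$$ Let $\lambda>0$ be a constant, independent of $\phi$, such that every $\psi\in H^2_{\mathrm{per}}(\Omega)$ with finite energy satisfies $\sup_\Omega|\psi|\le\sqrt{(\mathcal{E}(\psi)+(9\gamma^4+3)|\Omega|)/\lambda}$, and for $\phi^0\in H^2_{\mathrm{per}}(\Omega)$ with finite energy set $\mathcal{C}^0:=\sqrt{(\mathcal{E}(\phi^0)+(9\gamma^4+3)|\Omega|)/\lambda}$. For a constant $S>0$ and step size $\Delta t>0$, consider the convex splitting scheme: given $\phi^n$, find $\phi^{n+1}\in H^2_{\mathrm{per}}(\Omega)$ with $$\frac{\phi^{n+1}-\phi^n}{\Delta t}=-\Big(\delta_\phi\mathcal{E}^c(\phi^{n+1})-\delta_\phi\mathcal{E}^e(\phi^n)\Big)+\beta(\phi^n),\qquad n\in\mathbb{N},$$ where $$\delta_\phi\mathcal{E}^c(\phi)=(\Delta+1)^2\phi-\alpha\phi+S\phi,\qquad \delta_\phi\mathcal{E}^e(\phi)=S\phi-\tfrac{1}{6}\phi^3+\tfrac{\gamma}{2}\phi^2,$$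 $$\beta(\phi)=\frac{1}{|\Omega|}\int_\Omega\Big((1-\alpha)\phi+\frac{\phi^3}{3!}-\frac{\gamma}{2}\phi^2\Big)\,\mathrm{d}\boldsymbol{x}.$$ Then for any $\phi^0\in H^2_{\mathrm{per}}(\Omega)$ with finite energy $\mathcal{E}(\phi^0)$ there exists $S>0$ such that, for any $\Delta t>0$, the scheme is stable in the sense that $$\sup_{\Omega}|\phi^n|\le\mathcal{C}^0\quad\text{and}\quad \mathcal{E}(\phi^{n+1})\le\mathcal{E}(\phi^n)\qquad\text{for all }n\in\mathbb{N}.$$
   Context: $H^2_{\mathrm{per}}(\Omega)$ is the space of real-valued $\Omega$-periodic functions in the Sobolev space $H^2(\Omega)$. $\delta_\phi\mathcal{E}^c,\delta_\phi\mathcal{E}^e$ are the first variational derivatives of the convex splitting $\mathcal{E}=\mathcal{E}^c-\mathcal{E}^e$ with $\mathcal{E}^c(\phi)=\int_\Omega\{\frac12((\Delta+1)\phi)^2-\frac{\alpha}{2}\phi^2+\frac S2\phi^2\}$ and $\mathcal{E}^e(\phi)=\int_\Omega\{\frac S2\phi^2-\frac1{24}\phi^4+\frac{\gamma}{6}\phi^3\}$. The term $\beta$ is the Lagrange multiplier enforcing conservation of the mean $\frac1{|\Omega|}\int_\Omega\phi$. *)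

theory Defs
  imports "HOL-Analysis.Analysis" "HOL-Probability.Essential_Supremum"
begin

definition Omega :: "real^'d \<Rightarrow> (real^'d) set" where
  "Omega L = cbox 0 L"

definition vol :: "real^'d \<Rightarrow> real" where
  "vol L = measure lebesgue (Omega L)"

definition per :: "real^'d \<Rightarrow> (real^'d \<Rightarrow> real) \<Rightarrow> bool" where
  "per L f \<longleftrightarrow> (\<forall>x i. f (x + axis i (L $ i)) = f x)"

definition intO :: "real^'d \<Rightarrow> (real^'d \<Rightarrow> real) \<Rightarrow> real" where
  "intO L f = integral\<^sup>L (lebesgue_on (Omega L)) f"

definition L2on :: "real^'d \<Rightarrow> (real^'d \<Rightarrow> real) \<Rightarrow> bool" where
  "L2on L f \<longleftrightarrow> f \<in> borel_measurable (lebesgue_on (Omega L))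
     \<and> integrable (lebesgue_on (Omega L)) (\<lambda>x. (f x)\<^sup>2)"

definition pdiff :: "'d \<Rightarrow> (real^'d \<Rightarrow> real) \<Rightarrow> real^'d \<Rightarrow> real" where
  "pdiff i f x = frechet_derivative f (at x) (axis i 1)"

definition test_fun :: "real^'d \<Rightarrow> (real^'d \<Rightarrow> real) \<Rightarrow> bool" where
  "test_fun L v \<longleftrightarrow> per L v \<and> (\<forall>x. v differentiable (at x))
     \<and> (\<forall>i x. pdiff i v differentiable (at x))
     \<and> (\<forall>i j. continuous_on UNIV (pdiff j (pdiff i v)))"

definition weak_d1 :: "real^'d \<Rightarrow> (real^'d \<Rightarrow> real) \<Rightarrow> 'd \<Rightarrow> (real^'d \<Rightarrow> real) \<Rightarrow> bool" where
  "weak_d1 L f i g \<longleftrightarrow> (\<forall>v. test_fun L v \<longrightarrow>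
      intO L (\<lambda>x. f x * pdiff i v x) = - intO L (\<lambda>x. g x * v x))"

definition weak_d2 :: "real^'d \<Rightarrow> (real^'d \<Rightarrow> real) \<Rightarrow> 'd \<Rightarrow> 'd \<Rightarrow> (real^'d \<Rightarrow> real) \<Rightarrow> bool" where
  "weak_d2 L f i j g \<longleftrightarrow> (\<forall>v. test_fun L v \<longrightarrow>
      intO L (\<lambda>x. f x * pdiff j (pdiff i v) x) = intO L (\<lambda>x. g x * v x))"

definition H2per :: "real^'d \<Rightarrow> (real^'d \<Rightarrow> real) set" where
  "H2per L = {f. per L f \<and> L2on L f
      \<and> (\<forall>i. \<exists>g. L2on L g \<and> weak_d1 L f i g)
      \<and> (\<forall>i j. \<exists>g. L2on L g \<and> weak_d2 L f i j g)}"

text \<open>Weak Laplacian (a representative; unique a.e. on Omega).\<close>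
definition lap :: "real^'d \<Rightarrow> (real^'d \<Rightarrow> real) \<Rightarrow> real^'d \<Rightarrow> real" where
  "lap L f = (\<lambda>x. \<Sum>i\<in>UNIV. (SOME g. L2on L g \<and> weak_d2 L f i i g) x)"

definition edens :: "real^'d \<Rightarrow> real \<Rightarrow> real \<Rightarrow> (real^'d \<Rightarrow> real) \<Rightarrow> real^'d \<Rightarrow> real" where
  "edens L \<alpha> \<gamma> f x = 1/2 * (lap L f x + f x)\<^sup>2 - \<alpha>/2 * (f x)\<^sup>2
      + (f x)^4 / 24 - \<gamma>/6 * (f x)^3"

definition energy :: "real^'d \<Rightarrow> real \<Rightarrow> real \<Rightarrow> (real^'d \<Rightarrow> real) \<Rightarrow> real" where
  "energy L \<alpha> \<gamma> f = intO L (edens L \<alpha> \<gamma> f)"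

definition finite_energy :: "real^'d \<Rightarrow> real \<Rightarrow> real \<Rightarrow> (real^'d \<Rightarrow> real) \<Rightarrow> bool" where
  "finite_energy L \<alpha> \<gamma> f \<longleftrightarrow> integrable (lebesgue_on (Omega L)) (edens L \<alpha> \<gamma> f)"

text \<open>sup over Omega of |f| (essential supremum, i.e. the sup of the continuous representative).\<close>
definition supabs :: "real^'d \<Rightarrow> (real^'d \<Rightarrow> real) \<Rightarrow> ereal" where
  "supabs L f = esssup (lebesgue_on (Omega L)) (\<lambda>x. ereal \<bar>f x\<bar>)"

text \<open>First variation of E^c, paired (weakly) with a test function v in H2per:
  <(Delta+1)^2 u - alpha u + S u, v> = int ((Delta+1)u)((Delta+1)v) - alpha u v + S u v.\<close>
definition dEc_weak :: "real^'d \<Rightarrow> real \<Rightarrow> real \<Rightarrow> (real^'d \<Rightarrow> real) \<Rightarrow> (real^'d \<Rightarrow> real) \<Rightarrow> real" where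
  "dEc_weak L \<alpha> S u v = intO L (\<lambda>x. (lap L u x + u x) * (lap L v x + v x)
      - \<alpha> * u x * v x + S * u x * v x)"

definition dEe :: "real \<Rightarrow> real \<Rightarrow> (real^'d \<Rightarrow> real) \<Rightarrow> real^'d \<Rightarrow> real" where
  "dEe S \<gamma> u x = S * u x - (u x)^3 / 6 + \<gamma>/2 * (u x)\<^sup>2"

definition beta :: "real^'d \<Rightarrow> real \<Rightarrow> real \<Rightarrow> (real^'d \<Rightarrow> real) \<Rightarrow> real" where
  "beta L \<alpha> \<gamma> u = 1 / vol L * intO L (\<lambda>x. (1 - \<alpha>) * u x + (u x)^3 / fact 3 - \<gamma>/2 * (u x)\<^sup>2)"

definition scheme_step :: "real^'d \<Rightarrow> real \<Rightarrow> real \<Rightarrow> real \<Rightarrow> real \<Rightarrow>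
    (real^'d \<Rightarrow> real) \<Rightarrow> (real^'d \<Rightarrow> real) \<Rightarrow> bool" where
  "scheme_step L \<alpha> \<gamma> S dt u0 u1 \<longleftrightarrow> u1 \<in> H2per L \<and>
     (\<forall>v\<in>H2per L.
        intO L (\<lambda>x. (u1 x - u0 x) / dt * v x)
        = - (dEc_weak L \<alpha> S u1 v - intO L (\<lambda>x. dEe S \<gamma> u0 x * v x))
          + beta L \<alpha> \<gamma> u0 * intO L v)"

end

theory Submission
  imports Defs
begin

text \<open>
  Testing the scheme with the constant function shows that the mean is conserved, so the multiplier
  drops out when the scheme is tested with the increment. The resulting identity controls
  the $L^2$ norms of the new iterate and of its image under $\Delta + 1$ uniformly in $S \ge \alpha + 3/2$
  and in the time step; once the new iterate is also bounded pointwise by a constant not depending on $S$,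
  the quartic and cubic terms are dominated by $S$ times the squared increment and the energy decreases.

  The pointwise bound comes from the assumed inequality alone, not from a Sobolev embedding.
  For a bounded function, apply the assumption to a small multiple of it: the quartic term is at most the
  squared supremum times the squared $L^2$ norm, hence can be absorbed, and the supremum is bounded by the $L^2$ norms.
  For a general function apply this to its averages over small cubes, which are bounded, have no larger norms, and
  converge to the function at its Lebesgue points.
\<close>

subsection \<open>Periodic test functions\<close>

definition C2 :: "(real^'d \<Rightarrow> real) \<Rightarrow> bool" where
  "C2 v \<longleftrightarrow> (\<forall>x. v differentiable (at x)) \<and> (\<forall>i x. pdiff i v differentiable (at x))
     \<and> (\<forall>i j. continuous_on UNIV (pdiff j (pdiff i v)))"

lemma test_fun_iff: "test_fun L v \<longleftrightarrow> per L v \<and> C2 v"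
  by (simp add: test_fun_def C2_def)

lemma pdiff_eqI: "(v has_derivative v') (at x) \<Longrightarrow> pdiff i v x = v' (axis i 1)"
  unfolding pdiff_def by (metis frechet_derivative_at)

lemma pdiff_const: "pdiff i (\<lambda>x. c) = (\<lambda>x. 0)"
  by (rule ext) (simp add: pdiff_eqI[OF has_derivative_const])

lemma pdiff_add:
  assumes "u differentiable (at x)" "v differentiable (at x)"
  shows "pdiff i (\<lambda>x. u x + v x) x = pdiff i u x + pdiff i v x"
  using has_derivative_add[OF assms[unfolded frechet_derivative_works]]
  by (subst pdiff_eqI) (auto simp: pdiff_def)

lemma pdiff_mult:
  assumes "u differentiable (at x)" "v differentiable (at x)"
  shows "pdiff i (\<lambda>x. u x * v x) x = u x * pdiff i v x + pdiff i u x * v x"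
  using has_derivative_mult[OF assms[unfolded frechet_derivative_works]]
  by (subst pdiff_eqI) (auto simp: pdiff_def)

lemma has_derivative_compose_real:
  fixes u :: "real^'d \<Rightarrow> real"
  assumes "u differentiable (at x)" "(\<phi> has_real_derivative \<phi>1) (at (u x))"
  shows "((\<lambda>x. \<phi> (u x)) has_derivative (\<lambda>h. \<phi>1 * frechet_derivative u (at x) h)) (at x)"
  using has_derivative_compose[OF assms(1)[unfolded frechet_derivative_works]
      assms(2)[unfolded has_field_derivative_def]] by simp

lemma pdiff_compose:
  fixes u :: "real^'d \<Rightarrow> real"
  assumes "u differentiable (at x)" "(\<phi> has_real_derivative \<phi>1) (at (u x))"
  shows "pdiff i (\<lambda>x. \<phi> (u x)) x = \<phi>1 * pdiff i u x"
  using pdiff_eqI[OF has_derivative_compose_real[OF assms]] by (simp add: pdiff_def)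

lemma differentiable_compose_real:
  fixes u :: "real^'d \<Rightarrow> real"
  assumes "u differentiable (at x)" "(\<phi> has_real_derivative \<phi>1) (at (u x))"
  shows "(\<lambda>x. \<phi> (u x)) differentiable (at x)"
  using has_derivative_compose_real[OF assms] by (auto simp: differentiable_def)

lemma C2_continuous:
  assumes "C2 v"
  shows "continuous_on UNIV v" "continuous_on UNIV (pdiff i v)"
    "continuous_on UNIV (pdiff j (pdiff i v))"
  using assms by (auto simp: C2_def intro!: continuous_at_imp_continuous_on differentiable_imp_continuous_within)

lemma C2_compose:
  fixes u :: "real^'d \<Rightarrow> real"
  assumes u: "C2 u" and \<phi>: "\<And>s. (\<phi> has_real_derivative \<phi>1 s) (at s)"
    "\<And>s. (\<phi>1 has_real_derivative \<phi>2 s) (at s)" and c: "continuous_on UNIV \<phi>2"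
  shows "C2 (\<lambda>x. \<phi> (u x))"
proof -
  have du: "u differentiable (at x)" "pdiff i u differentiable (at x)" for x i
    using u by (auto simp: C2_def)
  have 1: "pdiff i (\<lambda>x. \<phi> (u x)) = (\<lambda>x. \<phi>1 (u x) * pdiff i u x)" for i
    by (rule ext) (rule pdiff_compose[OF du(1) \<phi>(1)])
  have d1: "(\<lambda>x. \<phi>1 (u x)) differentiable (at x)" for x
    by (rule differentiable_compose_real[OF du(1) \<phi>(2)])
  have 2: "pdiff j (\<lambda>x. \<phi>1 (u x) * pdiff i u x) =
     (\<lambda>x. \<phi>1 (u x) * pdiff j (pdiff i u) x + (\<phi>2 (u x) * pdiff j u x) * pdiff i u x)" for i j
    by (intro ext) (simp add: pdiff_mult[OF d1 du(2)] pdiff_compose[OF du(1) \<phi>(2)])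
  have c1: "continuous_on UNIV \<phi>1"
    by (rule DERIV_continuous_on, rule \<phi>(2)[THEN has_field_derivative_at_within])
  have "continuous_on UNIV (\<lambda>x. \<phi>1 (u x))" "continuous_on UNIV (\<lambda>x. \<phi>2 (u x))"
    by (rule continuous_on_compose2[OF c1 C2_continuous(1)[OF u]], simp,
        rule continuous_on_compose2[OF c C2_continuous(1)[OF u]], simp)
  then have "continuous_on UNIV (\<lambda>x. \<phi>1 (u x) * pdiff j (pdiff i u) x
      + (\<phi>2 (u x) * pdiff j u x) * pdiff i u x)" for i j
    using C2_continuous[OF u] by (intro continuous_on_add continuous_on_mult)
  then show ?thesis
    unfolding C2_def 1 2
    using differentiable_compose_real[OF du(1) \<phi>(1)] differentiable_mult[OF d1 du(2)] by simp
qed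

lemma C2_const: "C2 (\<lambda>x::real^'d. c)"
  by (simp add: C2_def pdiff_const)

lemma C2_coord: "C2 (\<lambda>x::real^'d. x $ k)"
proof -
  have d: "((\<lambda>x::real^'d. x $ k) has_derivative (\<lambda>h. h $ k)) (at x)" for x
    by (intro has_derivative_bounded_linear bounded_linear_vec_nth bounded_linear_imp_has_derivative)
  have "pdiff i (\<lambda>x::real^'d. x $ k) = (\<lambda>x. axis i 1 $ k)" for i
    by (intro ext pdiff_eqI d)
  moreover have "(\<lambda>x::real^'d. x $ k) differentiable (at x)" for x
    using d by (rule differentiableI)
  ultimately show ?thesis by (simp add: C2_def pdiff_const)
qed

lemma C2_add:
  assumes "C2 u" "C2 v" shows "C2 (\<lambda>x. u x + v x)"
proof -
  have d: "u differentiable (at x)" "pdiff i u differentiable (at x)"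
     "v differentiable (at x)" "pdiff i v differentiable (at x)" for x i
    using assms by (auto simp: C2_def)
  have 1: "pdiff i (\<lambda>x. u x + v x) = (\<lambda>x. pdiff i u x + pdiff i v x)" for i
    by (intro ext pdiff_add d)
  have 2: "pdiff j (\<lambda>x. pdiff i u x + pdiff i v x) = (\<lambda>x. pdiff j (pdiff i u) x + pdiff j (pdiff i v) x)" for i j
    by (intro ext pdiff_add d)
  show ?thesis unfolding C2_def 1 2
    using d differentiable_add C2_continuous[OF assms(1)] C2_continuous[OF assms(2)]
    by (simp add: continuous_on_add)
qed

lemma C2_sum:
  "finite I \<Longrightarrow> (\<And>i. i \<in> I \<Longrightarrow> C2 (u i)) \<Longrightarrow> C2 (\<lambda>x. \<Sum>i\<in>I. u i x)"
  by (induction I rule: finite_induct) (simp_all add: C2_const C2_add)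

lemma differentiable_shift:
  fixes v :: "real^'d \<Rightarrow> real"
  assumes "v differentiable (at (x - y))"
  shows "(\<lambda>x. v (x - y)) differentiable (at x)" "pdiff i (\<lambda>x. v (x - y)) x = pdiff i v (x - y)"
proof -
  have "((\<lambda>x. x - y) has_derivative (\<lambda>h. h)) (at x)"
    by (auto intro!: derivative_eq_intros)
  from has_derivative_compose[OF this assms[unfolded frechet_derivative_works]]
  have *: "((\<lambda>x. v (x - y)) has_derivative (\<lambda>h. frechet_derivative v (at (x - y)) h)) (at x)" .
  then show "(\<lambda>x. v (x - y)) differentiable (at x)" by (auto simp: differentiable_def)
  show "pdiff i (\<lambda>x. v (x - y)) x = pdiff i v (x - y)"
    using pdiff_eqI[OF *] by (simp add: pdiff_def)
qed

lemma test_fun_shift: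
  assumes "test_fun L v"
  shows "test_fun L (\<lambda>x. v (x - y))"
    "pdiff i (\<lambda>x. v (x - y)) = (\<lambda>x. pdiff i v (x - y))"
    "pdiff j (pdiff i (\<lambda>x. v (x - y))) = (\<lambda>x. pdiff j (pdiff i v) (x - y))"
proof -
  have C: "C2 v" and p: "per L v" using assms by (auto simp: test_fun_iff)
  have d: "v differentiable (at x)" "pdiff i v differentiable (at x)" for x i
    using C by (auto simp: C2_def)
  show 1: "pdiff i (\<lambda>x. v (x - y)) = (\<lambda>x. pdiff i v (x - y))" for i
    by (intro ext differentiable_shift d)
  show 2: "pdiff j (pdiff i (\<lambda>x. v (x - y))) = (\<lambda>x. pdiff j (pdiff i v) (x - y))" for i j
    unfolding 1 by (intro ext differentiable_shift d)
  have "per L (\<lambda>x. v (x - y))"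
    unfolding per_def
  proof safe
    fix x i
    show "v (x + axis i (L $ i) - y) = v (x - y)"
      using p[unfolded per_def, rule_format, of "x - y" i] by (simp add: algebra_simps)
  qed
  moreover have "C2 (\<lambda>x. v (x - y))"
    unfolding C2_def 2 unfolding 1
  proof (intro conjI allI)
    fix i j
    show "continuous_on UNIV (\<lambda>x. pdiff j (pdiff i v) (x - y))"
      by (rule continuous_on_compose2[OF C2_continuous(3)[OF C]]) (auto intro!: continuous_intros)
  qed (rule differentiable_shift d)+
  ultimately show "test_fun L (\<lambda>x. v (x - y))" by (simp add: test_fun_iff)
qed

lemma per_pdiff:
  assumes "per L v" "\<And>x. v differentiable (at x)"
  shows "per L (pdiff i v)"
  unfolding per_def
proof safe
  fix x k
  have "pdiff i (\<lambda>x. v (x - (- axis k (L $ k)))) x = pdiff i v (x - (- axis k (L $ k)))"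
    by (intro differentiable_shift assms)
  moreover have "(\<lambda>x. v (x - (- axis k (L $ k)))) = v"
    using assms(1) by (auto simp: per_def)
  ultimately show "pdiff i v (x + axis k (L $ k)) = pdiff i v x" by simp
qed

lemma test_fun_facts:
  assumes "test_fun L v"
  shows "per L v" "continuous_on UNIV v"
    "per L (pdiff i v)" "continuous_on UNIV (pdiff i v)"
    "per L (pdiff j (pdiff i v))" "continuous_on UNIV (pdiff j (pdiff i v))"
    "\<And>x. v differentiable (at x)" "\<And>x. pdiff i v differentiable (at x)"
proof -
  have C: "C2 v" and p: "per L v" using assms by (auto simp: test_fun_iff)
  show d: "\<And>x. v differentiable (at x)" "\<And>x. pdiff i v differentiable (at x)" for i
    using C by (auto simp: C2_def)
  show "per L v" "continuous_on UNIV v" "continuous_on UNIV (pdiff i v)"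
    "continuous_on UNIV (pdiff j (pdiff i v))"
    using C2_continuous[OF C] p by auto
  have P: "per L (pdiff i v)" for i by (rule per_pdiff[OF p d(1)])
  show "per L (pdiff i v)" by (rule P)
  show "per L (pdiff j (pdiff i v))" by (rule per_pdiff[OF P d(2)])
qed

lemma test_fun_const: "test_fun L (\<lambda>x. c)"
  by (simp add: test_fun_iff C2_const per_def)

text \<open>For large \<open>n\<close> this is close to 1 where all the cosine differences are positive and close to 0
  elsewhere, so a suitable choice of \<open>c\<close> and \<open>\<rho>\<close> yields smooth periodic approximations of the indicator
  of a box.\<close>

lemma test_fun_bump:
  fixes L :: "real^'d" and c \<rho> :: "'d \<Rightarrow> real"
  assumes "\<forall>i. 0 < L $ i"
  shows "test_fun L (\<lambda>x. exp (- (\<Sum>i\<in>UNIV. exp (n - n\<^sup>2 * (cos (2 * pi * (x $ i - c i) / L $ i) - \<rho> i)))))"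
proof -
  have nz: "L $ i \<noteq> 0" for i
    using assms by (metis less_irrefl)
  have "C2 (\<lambda>x::real^'d. cos (2 * pi * (x $ i - c i) / L $ i))" for i
    by (rule C2_compose[OF C2_coord, where
          ?\<phi>1.0 = "\<lambda>s. - (sin (2 * pi * (s - c i) / L $ i) * (2 * pi / L $ i))" and
          ?\<phi>2.0 = "\<lambda>s. - (cos (2 * pi * (s - c i) / L $ i) * (2 * pi / L $ i) * (2 * pi / L $ i))"])
       (auto intro!: derivative_eq_intros continuous_intros simp: nz)
  then have "C2 (\<lambda>x::real^'d. exp (n - n\<^sup>2 * (cos (2 * pi * (x $ i - c i) / L $ i) - \<rho> i)))" for i
    by (rule C2_compose[where ?\<phi>1.0 = "\<lambda>s. - n\<^sup>2 * exp (n - n\<^sup>2 * (s - \<rho> i))" and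
          ?\<phi>2.0 = "\<lambda>s. n\<^sup>2 * n\<^sup>2 * exp (n - n\<^sup>2 * (s - \<rho> i))"])
       (auto intro!: derivative_eq_intros continuous_intros)
  then have "C2 (\<lambda>x::real^'d. \<Sum>i\<in>UNIV. exp (n - n\<^sup>2 * (cos (2 * pi * (x $ i - c i) / L $ i) - \<rho> i)))"
    by (intro C2_sum) auto
  then have "C2 (\<lambda>x. exp (- (\<Sum>i\<in>UNIV. exp (n - n\<^sup>2 * (cos (2 * pi * (x $ i - c i) / L $ i) - \<rho> i)))))"
    by (rule C2_compose[where ?\<phi>1.0 = "\<lambda>s. - exp (- s)" and ?\<phi>2.0 = "\<lambda>s. exp (- s)"])
       (auto intro!: derivative_eq_intros continuous_intros)
  moreover have "per L (\<lambda>x. exp (- (\<Sum>i\<in>UNIV. exp (n - n\<^sup>2 * (cos (2 * pi * (x $ i - c i) / L $ i) - \<rho> i)))))"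
  proof -
    have "cos (2 * pi * ((x + axis k (L $ k)) $ i - c i) / L $ i) = cos (2 * pi * (x $ i - c i) / L $ i)" for x i k
    proof (cases "i = k")
      case True
      have "2 * pi * ((x + axis k (L $ k)) $ i - c i) / L $ i = 2 * pi * (x $ i - c i) / L $ i + 2 * pi"
        using assms[rule_format, of i] True by (simp add: field_simps axis_def)
      then show ?thesis by (metis cos_periodic)
    qed (simp add: axis_def)
    then show ?thesis unfolding per_def by presburger
  qed
  ultimately show ?thesis by (simp add: test_fun_iff)
qed

subsection \<open>Lebesgue points and the fundamental lemma\<close>

abbreviation LM :: "real^'d \<Rightarrow> (real^'d) measure" where
  "LM L \<equiv> lebesgue_on (Omega L)"

lemma Omega_lmeasurable: "Omega L \<in> lmeasurable" "Omega L \<in> sets lebesgue"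
  by (auto simp: Omega_def)

lemma finite_measure_LM: "finite_measure (LM L)"
  by (rule finite_measure_lebesgue_on[OF Omega_lmeasurable(1)])

lemma space_LM [simp]: "space (LM L) = Omega L"
  by (simp add: space_restrict_space)

lemma mem_Omega: "x \<in> Omega L \<longleftrightarrow> (\<forall>i. 0 \<le> x $ i \<and> x $ i \<le> L $ i)"
  by (simp add: Omega_def mem_box_cart)

lemma vol_pos: "\<forall>i. 0 < L $ i \<Longrightarrow> 0 < vol L"
  using content_cbox_cart[of 0 L]
  by (simp add: vol_def Omega_def interval_ne_empty_cart less_imp_le prod_pos)

lemma measurable_LM: "F \<in> borel_measurable borel \<Longrightarrow> F \<in> borel_measurable (LM L)"
  by (intro measurable_restrict_space1 measurable_completion) simp

lemma One_nth [simp]: "(One :: real^'d) $ i = 1"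
  by (simp add: cart_eq_inner_axis inner_sum_left_Basis del: sum_component)

lemma sum_Basis_nth [simp]: "(\<Sum>b\<in>(Basis :: (real^'d) set). b $ i) = 1"
  using One_nth[of i] by (simp add: sum_component del: One_nth)

lemma AE_LM_box: "AE x in LM L. x \<in> box 0 L"
proof -
  have "cbox 0 L - box 0 L \<in> null_sets lebesgue"
    using negligible_frontier_interval negligible_iff_null_sets by blast
  from AE_not_in[OF this] show ?thesis
    by (subst AE_restrict_space_iff) (auto simp: Omega_def elim: eventually_mono)
qed

lemma integrable_LM_iff:
  "integrable (LM L) (G :: real^'d \<Rightarrow> real) \<longleftrightarrow> integrable lebesgue (\<lambda>x. indicator (Omega L) x * G x)"
  by (simp add: integrable_restrict_space Omega_def)

lemma lebesgue_points:
  fixes G :: "real^'d \<Rightarrow> real"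
  assumes "integrable (LM L) G"
  shows "AE x in LM L. \<forall>e>0. \<exists>d>0. \<forall>h. 0 < h \<and> h < d \<longrightarrow> cbox x (x + h *\<^sub>R One) \<subseteq> box 0 L \<and>
      \<bar>(LINT y:cbox x (x + h *\<^sub>R One)|lebesgue. G y) / h ^ CARD('d) - G x\<bar> < e"
proof -
  define G0 where "G0 = (\<lambda>x. indicator (Omega L) x * G x)"
  have G0: "integrable lebesgue G0"
    using assms by (simp add: G0_def integrable_LM_iff)
  have si: "set_integrable lebesgue (cbox a b) G0" for a b
    unfolding set_integrable_def by (rule integrable_mult_indicator[OF _ G0]) simp
  then have "G0 integrable_on cbox a b" for a b
    by (rule set_lebesgue_integral_eq_integral(1))
  then obtain N where N: "negligible N"
    "\<And>x e. x \<notin> N \<Longrightarrow> 0 < e \<Longrightarrow> \<exists>d>0. \<forall>h. 0 < h \<and> h < d \<longrightarrow>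
           norm (integral (cbox x (x + h *\<^sub>R One)) G0 /\<^sub>R h ^ DIM(real^'d) - G0 x) < e"
    using integrable_ccontinuous_explicit[of G0] by metis
  have "AE x in lebesgue. x \<notin> N"
    using N(1) by (intro AE_not_in) (simp add: negligible_iff_null_sets)
  then have "AE x in LM L. x \<notin> N"
    by (subst AE_restrict_space_iff) (auto simp: Omega_def elim: eventually_mono)
  with AE_LM_box[of L] show ?thesis
  proof eventually_elim
    case (elim x)
    show ?case
    proof safe
      fix e :: real assume e: "0 < e"
      obtain d where d: "d > 0" "\<And>h. 0 < h \<Longrightarrow> h < d \<Longrightarrow>
           norm (integral (cbox x (x + h *\<^sub>R One)) G0 /\<^sub>R h ^ DIM(real^'d) - G0 x) < e"
        using N(2)[OF elim(2) e] by auto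
      define d0 where "d0 = Min (range (\<lambda>i. L $ i - x $ i))"
      have x: "0 < x $ i" "x $ i < L $ i" for i
        using elim(1) by (auto simp: mem_box_cart)
      have "d0 > 0" unfolding d0_def by (subst Min_gr_iff) (auto simp: x)
      have d0: "d0 \<le> L $ i - x $ i" for i
        unfolding d0_def by (rule Min_le) auto
      have sub: "cbox x (x + h *\<^sub>R One) \<subseteq> box 0 L" if "0 < h" "h < d0" for h
      proof
        fix y assume "y \<in> cbox x (x + h *\<^sub>R One)"
        then have y: "x $ i \<le> y $ i" "y $ i \<le> x $ i + h" for i
          by (auto simp: mem_box_cart)
        show "y \<in> box 0 L"
          unfolding mem_box_cart
        proof (intro allI conjI)
          fix i
          show "0 $ i < y $ i" using x(1)[of i] y(1)[of i] by simp
          show "y $ i < L $ i" using d0[of i] that y(2)[of i] by linarith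
        qed
      qed
      show "\<exists>d>0. \<forall>h. 0 < h \<and> h < d \<longrightarrow> cbox x (x + h *\<^sub>R One) \<subseteq> box 0 L \<and>
         \<bar>(LINT y:cbox x (x + h *\<^sub>R One)|lebesgue. G y) / h ^ CARD('d) - G x\<bar> < e"
      proof (intro exI[of _ "min d d0"] conjI allI impI)
        show "0 < min d d0" using d(1) \<open>d0 > 0\<close> by simp
        fix h assume h: "0 < h \<and> h < min d d0"
        then show sb: "cbox x (x + h *\<^sub>R One) \<subseteq> box 0 L" using sub by simp
        have bO: "box 0 L \<subseteq> Omega L" using box_subset_cbox[of 0 L] by (simp add: Omega_def)
        have "(LINT y:cbox x (x + h *\<^sub>R One)|lebesgue. G y) = (LINT y:cbox x (x + h *\<^sub>R One)|lebesgue. G0 y)"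
          by (rule set_lebesgue_integral_cong) (use sb bO in \<open>auto simp: G0_def indicator_def\<close>)
        also have "\<dots> = integral (cbox x (x + h *\<^sub>R One)) G0"
          by (rule set_lebesgue_integral_eq_integral(2)[OF si])
        finally show "\<bar>(LINT y:cbox x (x + h *\<^sub>R One)|lebesgue. G y) / h ^ CARD('d) - G x\<bar> < e"
          using d(2)[of h] h elim(1) bO by (auto simp: G0_def indicator_def divide_inverse mult.commute)
      qed
    qed
  qed
qed

lemma cos_gt_cos_iff:
  assumes "0 < \<rho>" "\<rho> \<le> pi" "0 \<le> \<theta>" "\<theta> \<le> 2 * pi - \<rho>"
  shows "cos \<theta> > cos \<rho> \<longleftrightarrow> \<theta> < \<rho>"
proof (cases "\<theta> \<le> pi")
  case True
  then show ?thesis using cos_mono_less_eq[of \<rho> \<theta>] assms by simp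
next
  case False
  have "cos (2 * pi - \<theta>) \<le> cos \<rho>"
    using assms False by (intro cos_monotone_0_pi_le) auto
  then have "cos \<theta> \<le> cos \<rho>" by (simp add: cos_diff)
  then show ?thesis using False assms by auto
qed

lemma tendsto_exp_minus: "(\<lambda>n. exp (- real n)) \<longlonglongrightarrow> 0"
proof -
  have "(\<lambda>n. exp (- 1 :: real) ^ n) \<longlonglongrightarrow> 0"
    by (rule LIMSEQ_power_zero) simp
  then show ?thesis by (simp add: exp_of_nat_mult[symmetric])
qed

lemma bump_limit:
  fixes L a b x :: "real^'d"
  assumes Lpos: "\<forall>i. 0 < L $ i" and ab: "\<And>i. a $ i < b $ i" "cbox a b \<subseteq> Omega L" and x: "x \<in> Omega L"
  shows "(\<lambda>n. exp (- (\<Sum>i\<in>UNIV. exp (real n - (real n)\<^sup>2 *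
            (cos (2 * pi * (x $ i - (a $ i + b $ i) / 2) / L $ i) - cos (pi * (b $ i - a $ i) / L $ i))))))
          \<longlonglongrightarrow> indicator (box a b) x"
proof -
  define q where "q i = cos (2 * pi * (x $ i - (a $ i + b $ i) / 2) / L $ i) - cos (pi * (b $ i - a $ i) / L $ i)" for i
  have "a \<in> Omega L" "b \<in> Omega L"
    using ab by (auto intro!: subsetD[OF ab(2)] simp: mem_box_cart less_imp_le)
  then have O: "0 \<le> a $ i" "b $ i \<le> L $ i" "0 \<le> x $ i" "x $ i \<le> L $ i" for i
    using x by (auto simp: mem_Omega)
  have q: "q i > 0 \<longleftrightarrow> a $ i < x $ i \<and> x $ i < b $ i" for i
  proof -
    define c where "c = (a $ i + b $ i) / 2"
    define r where "r = (b $ i - a $ i) / 2"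
    have r: "0 < r" "r \<le> L $ i / 2" and xc: "\<bar>x $ i - c\<bar> \<le> L $ i - r"
      using O[of i] ab(1)[of i] by (auto simp: r_def c_def field_simps abs_le_iff)
    have Li: "0 < L $ i" using Lpos by simp
    have "cos (2 * pi * (x $ i - c) / L $ i) = cos (2 * pi * \<bar>x $ i - c\<bar> / L $ i)"
    proof (cases "x $ i - c \<ge> 0")
      case False
      then have "\<bar>x $ i - c\<bar> = - (x $ i - c)" by simp
      then have "2 * pi * \<bar>x $ i - c\<bar> / L $ i = - (2 * pi * (x $ i - c) / L $ i)"
        by (simp only: mult_minus_right minus_divide_left)
      then show ?thesis by (simp only: cos_minus)
    qed simp
    moreover have "cos (2 * pi * \<bar>x $ i - c\<bar> / L $ i) > cos (2 * pi * r / L $ i) \<longleftrightarrow>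
       2 * pi * \<bar>x $ i - c\<bar> / L $ i < 2 * pi * r / L $ i"
    proof (rule cos_gt_cos_iff)
      have "2 * pi * \<bar>x $ i - c\<bar> / L $ i \<le> 2 * pi * (L $ i - r) / L $ i"
        using xc Li by (intro divide_right_mono mult_left_mono) auto
      then show "2 * pi * \<bar>x $ i - c\<bar> / L $ i \<le> 2 * pi - 2 * pi * r / L $ i"
        using Li by (simp add: field_simps)
      have "2 * pi * r / L $ i \<le> 2 * pi * (L $ i / 2) / L $ i"
        using r Li by (intro divide_right_mono mult_left_mono) auto
      then show "2 * pi * r / L $ i \<le> pi" using Li by simp
    qed (use r Li in auto)
    moreover have "2 * pi * \<bar>x $ i - c\<bar> / L $ i < 2 * pi * r / L $ i \<longleftrightarrow> \<bar>x $ i - c\<bar> < r"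
      using Li by (simp add: divide_less_cancel)
    moreover have "\<bar>x $ i - c\<bar> < r \<longleftrightarrow> a $ i < x $ i \<and> x $ i < b $ i"
      by (auto simp: r_def c_def abs_less_iff field_simps)
    moreover have "pi * (b $ i - a $ i) / L $ i = 2 * pi * r / L $ i"
      by (simp add: r_def)
    ultimately show ?thesis unfolding q_def c_def[symmetric] by (metis diff_gt_0_iff_gt)
  qed
  have "(\<lambda>n. exp (- (\<Sum>i\<in>UNIV. exp (real n - (real n)\<^sup>2 * q i)))) \<longlonglongrightarrow> indicator (box a b) x"
  proof (cases "x \<in> box a b")
    case True
    then have qp: "q i > 0" for i unfolding q by (auto simp: mem_box_cart)
    have "(\<lambda>n. exp (real n - (real n)\<^sup>2 * q i)) \<longlonglongrightarrow> 0" for i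
    proof (rule tendsto_sandwich[OF _ _ tendsto_const tendsto_exp_minus])
      obtain N where N: "real N > 2 / q i" using reals_Archimedean2 by blast
      show "\<forall>\<^sub>F n in sequentially. exp (real n - (real n)\<^sup>2 * q i) \<le> exp (- real n)"
      proof (rule eventually_sequentiallyI[of N])
        fix n assume "N \<le> n"
        then have "real n > 2 / q i" using N by (meson less_le_trans of_nat_le_iff)
        then have "2 < real n * q i" using qp[of i] by (simp add: field_simps)
        then have "real n * 2 \<le> real n * (real n * q i)" by (intro mult_left_mono) auto
        then show "exp (real n - (real n)\<^sup>2 * q i) \<le> exp (- real n)"
          by (simp add: power2_eq_square)
      qed
    qed simp
    then have "(\<lambda>n. exp (- (\<Sum>i\<in>UNIV. exp (real n - (real n)\<^sup>2 * q i)))) \<longlonglongrightarrow> exp (- (\<Sum>i\<in>(UNIV::'d set). 0))"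
      by (intro tendsto_exp tendsto_minus tendsto_sum)
    with True show ?thesis by simp
  next
    case False
    then obtain k where "\<not> q k > 0" unfolding q by (auto simp: mem_box_cart)
    then have k: "q k \<le> 0" by simp
    have "exp (- (\<Sum>i\<in>UNIV. exp (real n - (real n)\<^sup>2 * q i))) \<le> exp (- real n)" for n
    proof -
      have "real n \<le> real n - (real n)\<^sup>2 * q k"
        using k by (simp add: mult_nonneg_nonpos)
      also have "\<dots> \<le> exp (real n - (real n)\<^sup>2 * q k)"
        using exp_ge_add_one_self[of "real n - (real n)\<^sup>2 * q k"] by linarith
      also have "\<dots> \<le> (\<Sum>i\<in>UNIV. exp (real n - (real n)\<^sup>2 * q i))"
        by (rule member_le_sum) auto
      finally show ?thesis by simp
    qed
    then have "(\<lambda>n. exp (- (\<Sum>i\<in>UNIV. exp (real n - (real n)\<^sup>2 * q i)))) \<longlonglongrightarrow> 0"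
      by (intro tendsto_sandwich[OF _ _ tendsto_const tendsto_exp_minus]) auto
    with False show ?thesis by simp
  qed
  then show ?thesis by (simp add: q_def)
qed

lemma fundamental_lemma:
  fixes L :: "real^'d"
  assumes Lpos: "\<forall>i. 0 < L $ i" and G: "integrable (LM L) G"
    and z: "\<And>v. test_fun L v \<Longrightarrow> intO L (\<lambda>x. G x * v x) = 0"
  shows "AE x in LM L. G x = 0"
proof -
  have cube: "(LINT y:cbox a b|lebesgue. G y) = 0"
    if ab: "\<And>i. a $ i < b $ i" "cbox a b \<subseteq> Omega L" for a b
  proof -
    define v where "v n x = exp (- (\<Sum>i\<in>UNIV. exp (real n - (real n)\<^sup>2 *
            (cos (2 * pi * (x $ i - (a $ i + b $ i) / 2) / L $ i) - cos (pi * (b $ i - a $ i) / L $ i)))))"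
      for n and x :: "real^'d"
    have tv: "test_fun L (v n)" for n
      unfolding v_def by (rule test_fun_bump[OF Lpos])
    have vm: "v n \<in> borel_measurable (LM L)" for n
      by (intro measurable_LM borel_measurable_continuous_onI test_fun_facts(2)[OF tv])
    have v01: "0 \<le> v n x" "v n x \<le> 1" for n x
      by (auto simp: v_def sum_nonneg)
    have Gm: "G \<in> borel_measurable (LM L)" using G by simp
    have "(\<lambda>n. intO L (\<lambda>x. G x * v n x)) \<longlonglongrightarrow> integral\<^sup>L (LM L) (\<lambda>x. G x * indicator (box a b) x)"
      unfolding intO_def
    proof (rule integral_dominated_convergence[where w="\<lambda>x. \<bar>G x\<bar>"])
      show "(\<lambda>x. G x * indicator (box a b) x) \<in> borel_measurable (LM L)"
        by (intro borel_measurable_times Gm measurable_LM) simp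
      show "(\<lambda>x. G x * v n x) \<in> borel_measurable (LM L)" for n
        by (intro borel_measurable_times Gm vm)
      show "integrable (LM L) (\<lambda>x. \<bar>G x\<bar>)" using G by simp
      show "AE x in LM L. (\<lambda>n. G x * v n x) \<longlonglongrightarrow> G x * indicator (box a b) x"
        using bump_limit[OF Lpos ab] by (intro AE_I2 tendsto_mult tendsto_const) (simp add: v_def)
      show "AE x in LM L. norm (G x * v n x) \<le> \<bar>G x\<bar>" for n
        using v01[of n] by (intro AE_I2) (simp add: abs_mult mult_left_le)
    qed
    then have "0 = integral\<^sup>L (LM L) (\<lambda>x. G x * indicator (box a b) x)"
      using z[OF tv] LIMSEQ_unique[OF tendsto_const] by fastforce
    also have "\<dots> = integral\<^sup>L lebesgue (\<lambda>x. indicator (Omega L) x * (G x * indicator (box a b) x))"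
      by (simp add: integral_restrict_space Omega_def)
    finally have 0: "integral\<^sup>L lebesgue (\<lambda>x. indicator (Omega L) x * (G x * indicator (box a b) x)) = 0" by (rule sym)
    have GO: "(\<lambda>x. indicator (Omega L) x * G x) \<in> borel_measurable lebesgue"
      using G unfolding integrable_LM_iff by (rule borel_measurable_integrable)
    have "(\<lambda>x. indicator (cbox a b) x * (indicator (Omega L) x * G x)) \<in> borel_measurable lebesgue"
      by (rule borel_measurable_times[OF borel_measurable_indicator GO]) simp
    also have "(\<lambda>x. indicator (cbox a b) x * (indicator (Omega L) x * G x)) = (\<lambda>x. indicator (cbox a b) x *\<^sub>R G x)"
      using ab(2) by (auto simp: indicator_def fun_eq_iff)
    finally have m1: "(\<lambda>x. indicator (cbox a b) x *\<^sub>R G x) \<in> borel_measurable lebesgue" .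
    have m2: "(\<lambda>x. indicator (Omega L) x * (G x * indicator (box a b) x)) \<in> borel_measurable lebesgue"
      unfolding mult.assoc[symmetric] by (rule borel_measurable_times[OF GO borel_measurable_indicator]) simp
    have "cbox a b - box a b \<in> null_sets lebesgue"
      using negligible_frontier_interval negligible_iff_null_sets by blast
    from AE_not_in[OF this]
    have "AE x in lebesgue. indicator (Omega L) x * (G x * indicator (box a b) x) = indicator (cbox a b) x *\<^sub>R G x"
    proof eventually_elim
      case (elim x)
      then have "x \<in> box a b \<longleftrightarrow> x \<in> cbox a b"
        using box_subset_cbox[of a b] by blast
      moreover have "x \<in> cbox a b \<Longrightarrow> x \<in> Omega L"
        using ab(2) by blast
      ultimately show ?case by (simp add: indicator_def)
    qed
    from integral_cong_AE[OF m2 m1 this] 0 show ?thesis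
      unfolding set_lebesgue_integral_def by (rule trans[OF sym])
  qed
  show ?thesis
    using lebesgue_points[OF G]
  proof eventually_elim
    case (elim x)
    have "\<bar>G x\<bar> < e" if e: "e > 0" for e
    proof -
      obtain d where d: "d > 0" "\<And>h. 0 < h \<Longrightarrow> h < d \<Longrightarrow> cbox x (x + h *\<^sub>R One) \<subseteq> box 0 L \<and>
         \<bar>(LINT y:cbox x (x + h *\<^sub>R One)|lebesgue. G y) / h ^ CARD('d) - G x\<bar> < e"
        using elim e by meson
      have h: "0 < d / 2" "d / 2 < d" using d(1) by auto
      have "cbox x (x + (d / 2) *\<^sub>R One) \<subseteq> Omega L"
        using d(2)[OF h] box_subset_cbox[of 0 L] by (auto simp: Omega_def)
      then have "(LINT y:cbox x (x + (d / 2) *\<^sub>R One)|lebesgue. G y) = 0"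
        using h(1) by (intro cube) auto
      then show ?thesis using d(2)[OF h] by simp
    qed
    then show ?case by (metis zero_less_abs_iff order_less_irrefl)
  qed
qed

subsection \<open>Weak derivatives and the Laplacian on periodic Sobolev functions\<close>

lemma L2onD:
  assumes "L2on L f"
  shows "f \<in> borel_measurable (LM L)" "integrable (LM L) (\<lambda>x. (f x)\<^sup>2)"
  using assms by (auto simp: L2on_def)

lemma L2on_integrable_mult:
  assumes "L2on L f" "L2on L g" shows "integrable (LM L) (\<lambda>x. f x * g x)"
proof (rule Bochner_Integration.integrable_bound)
  show "integrable (LM L) (\<lambda>x. (f x)\<^sup>2 + (g x)\<^sup>2)"
    by (intro Bochner_Integration.integrable_add L2onD assms)
  show "(\<lambda>x. f x * g x) \<in> borel_measurable (LM L)"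
    by (intro borel_measurable_times L2onD assms)
  have "\<bar>f x * g x\<bar> \<le> (f x)\<^sup>2 + (g x)\<^sup>2" for x
    using sum_squares_bound[of "\<bar>f x\<bar>" "\<bar>g x\<bar>"] mult_nonneg_nonneg[OF abs_ge_zero[of "f x"] abs_ge_zero[of "g x"]]
    by (simp add: abs_mult del: mult_nonneg_nonneg)
  then show "AE x in LM L. norm (f x * g x) \<le> norm ((f x)\<^sup>2 + (g x)\<^sup>2)"
    by (intro AE_I2) simp
qed

lemma L2on_const: "L2on L (\<lambda>x. c)"
  unfolding L2on_def using finite_measure.integrable_const[OF finite_measure_LM] by auto

lemma L2on_integrable: "L2on L f \<Longrightarrow> integrable (LM L) f"
  using L2on_integrable_mult[OF _ L2on_const[of L 1]] by simp

lemma L2on_linear: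
  assumes "L2on L f" "L2on L g" shows "L2on L (\<lambda>x. a * f x + b * g x)"
proof -
  have "integrable (LM L) (\<lambda>x. a\<^sup>2 * (f x)\<^sup>2 + 2 * a * b * (f x * g x) + b\<^sup>2 * (g x)\<^sup>2)"
    by (intro Bochner_Integration.integrable_add integrable_mult_right L2onD assms L2on_integrable_mult)
  moreover have "a\<^sup>2 * (f x)\<^sup>2 + 2 * a * b * (f x * g x) + b\<^sup>2 * (g x)\<^sup>2 = (a * f x + b * g x)\<^sup>2" for x
    by (simp add: power2_eq_square algebra_simps)
  ultimately show ?thesis
    using L2onD(1)[OF assms(1)] L2onD(1)[OF assms(2)] by (simp add: L2on_def)
qed

lemma L2on_add: "L2on L f \<Longrightarrow> L2on L g \<Longrightarrow> L2on L (\<lambda>x. f x + g x)"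
  using L2on_linear[of L f g 1 1] by simp

lemma L2on_diff: "L2on L f \<Longrightarrow> L2on L g \<Longrightarrow> L2on L (\<lambda>x. f x - g x)"
  using L2on_linear[of L f g 1 "-1"] by simp

lemma L2on_sum: "finite I \<Longrightarrow> (\<And>i. i \<in> I \<Longrightarrow> L2on L (f i)) \<Longrightarrow> L2on L (\<lambda>x. \<Sum>i\<in>I. f i x)"
  by (induction I rule: finite_induct) (simp_all add: L2on_const L2on_add)

lemma L2on_bounded:
  assumes "f \<in> borel_measurable (LM L)" "AE x in LM L. \<bar>f x\<bar> \<le> B"
  shows "L2on L f"
proof -
  have "AE x in LM L. norm ((f x)\<^sup>2) \<le> B\<^sup>2"
    using assms(2)
  proof eventually_elim
    case (elim x)
    then have "\<bar>f x\<bar>\<^sup>2 \<le> B\<^sup>2" by (intro power_mono) auto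
    then show ?case by simp
  qed
  then have "integrable (LM L) (\<lambda>x. (f x)\<^sup>2)"
    using assms(1) by (intro finite_measure.integrable_const_bound[OF finite_measure_LM]) auto
  with assms(1) show ?thesis by (simp add: L2on_def)
qed

lemma continuous_bounded_Omega:
  assumes "continuous_on UNIV (v :: real^'d \<Rightarrow> real)"
  obtains B where "0 \<le> B" "\<And>x. x \<in> Omega L \<Longrightarrow> \<bar>v x\<bar> \<le> B"
proof -
  have "compact (v ` Omega L)"
    using assms by (intro compact_continuous_image) (auto simp: Omega_def intro: continuous_on_subset)
  then obtain B where "\<forall>y\<in>v ` Omega L. norm y \<le> B"
    using compact_imp_bounded bounded_iff by metis
  then show ?thesis by (intro that[of "max 0 B"]) (auto simp: le_max_iff_disj)
qed

lemma L2on_continuous: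
  assumes "continuous_on UNIV (v :: real^'d \<Rightarrow> real)" shows "L2on L v"
proof -
  obtain B where "\<And>x. x \<in> Omega L \<Longrightarrow> \<bar>v x\<bar> \<le> B"
    using continuous_bounded_Omega[OF assms, of L] by metis
  then show ?thesis
    using assms by (intro L2on_bounded[where B=B] measurable_LM borel_measurable_continuous_onI AE_I2) auto
qed

lemma test_fun_L2on:
  assumes "test_fun L v"
  shows "L2on L v" "L2on L (pdiff i v)" "L2on L (pdiff j (pdiff i v))"
  using test_fun_facts[OF assms] by (auto intro: L2on_continuous)

lemma intO_linear:
  assumes "integrable (LM L) f" "integrable (LM L) g"
  shows "intO L (\<lambda>x. a * f x + b * g x) = a * intO L f + b * intO L g"
  using assms by (simp add: intO_def)

lemma weak_d1_linear:
  assumes L2: "L2on L f" "L2on L g" "L2on L F" "L2on L G" and w: "weak_d1 L f i F" "weak_d1 L g i G"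
  shows "weak_d1 L (\<lambda>x. a * f x + b * g x) i (\<lambda>x. a * F x + b * G x)"
  unfolding weak_d1_def
proof (intro allI impI)
  fix v assume v: "test_fun L v"
  have "intO L (\<lambda>x. (a * f x + b * g x) * pdiff i v x) = intO L (\<lambda>x. a * (f x * pdiff i v x) + b * (g x * pdiff i v x))"
    by (simp add: algebra_simps)
  also have "\<dots> = a * intO L (\<lambda>x. f x * pdiff i v x) + b * intO L (\<lambda>x. g x * pdiff i v x)"
    by (intro intO_linear L2on_integrable_mult L2 test_fun_L2on v)
  also have "\<dots> = - (a * intO L (\<lambda>x. F x * v x) + b * intO L (\<lambda>x. G x * v x))"
    using w v by (simp add: weak_d1_def)
  also have "a * intO L (\<lambda>x. F x * v x) + b * intO L (\<lambda>x. G x * v x) = intO L (\<lambda>x. a * (F x * v x) + b * (G x * v x))"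
    by (intro intO_linear[symmetric] L2on_integrable_mult L2 test_fun_L2on(1) v)
  finally show "intO L (\<lambda>x. (a * f x + b * g x) * pdiff i v x) = - intO L (\<lambda>x. (a * F x + b * G x) * v x)"
    by (simp add: algebra_simps)
qed

lemma weak_d2_linear:
  assumes L2: "L2on L f" "L2on L g" "L2on L F" "L2on L G" and w: "weak_d2 L f i j F" "weak_d2 L g i j G"
  shows "weak_d2 L (\<lambda>x. a * f x + b * g x) i j (\<lambda>x. a * F x + b * G x)"
  unfolding weak_d2_def
proof (intro allI impI)
  fix v assume v: "test_fun L v"
  let ?p = "pdiff j (pdiff i v)"
  have "intO L (\<lambda>x. (a * f x + b * g x) * ?p x) = intO L (\<lambda>x. a * (f x * ?p x) + b * (g x * ?p x))"
    by (simp add: algebra_simps)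
  also have "\<dots> = a * intO L (\<lambda>x. f x * ?p x) + b * intO L (\<lambda>x. g x * ?p x)"
    by (intro intO_linear L2on_integrable_mult L2 test_fun_L2on v)
  also have "\<dots> = a * intO L (\<lambda>x. F x * v x) + b * intO L (\<lambda>x. G x * v x)"
    using w v by (simp add: weak_d2_def)
  also have "a * intO L (\<lambda>x. F x * v x) + b * intO L (\<lambda>x. G x * v x) = intO L (\<lambda>x. a * (F x * v x) + b * (G x * v x))"
    by (intro intO_linear[symmetric] L2on_integrable_mult L2 test_fun_L2on(1) v)
  finally show "intO L (\<lambda>x. (a * f x + b * g x) * ?p x) = intO L (\<lambda>x. (a * F x + b * G x) * v x)"
    by (simp add: algebra_simps)
qed

lemma weak_d2_unique:
  assumes Lpos: "\<forall>i. 0 < L $ i" and L2: "L2on L F" "L2on L G" and w: "weak_d2 L f i j F" "weak_d2 L f i j G"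
  shows "AE x in LM L. F x = G x"
proof -
  have "AE x in LM L. F x - G x = 0"
  proof (rule fundamental_lemma[OF Lpos])
    show "integrable (LM L) (\<lambda>x. F x - G x)"
      by (intro L2on_integrable L2on_diff L2)
    fix v assume v: "test_fun L v"
    have "intO L (\<lambda>x. 1 * (F x * v x) + (-1) * (G x * v x)) = 1 * intO L (\<lambda>x. F x * v x) + (-1) * intO L (\<lambda>x. G x * v x)"
      by (intro intO_linear L2on_integrable_mult L2 test_fun_L2on(1) v)
    also have "\<dots> = 0" using w v unfolding weak_d2_def by fastforce
    finally show "intO L (\<lambda>x. (F x - G x) * v x) = 0" by (simp add: algebra_simps)
  qed
  then show ?thesis by simp
qed

lemma H2perD:
  assumes "f \<in> H2per L"
  shows "per L f" "L2on L f" "\<exists>g. L2on L g \<and> weak_d1 L f i g" "\<exists>g. L2on L g \<and> weak_d2 L f i j g"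
  using assms by (auto simp: H2per_def)

lemma lap_eqI:
  fixes L :: "real^'d"
  assumes Lpos: "\<forall>i. 0 < L $ i" and G: "\<And>i. L2on L (G i)" "\<And>i. weak_d2 L f i i (G i)"
  shows "AE x in LM L. lap L f x = (\<Sum>i\<in>UNIV. G i x)"
proof -
  define H where "H i = (SOME g. L2on L g \<and> weak_d2 L f i i g)" for i
  have H: "L2on L (H i) \<and> weak_d2 L f i i (H i)" for i
    unfolding H_def by (rule someI[of _ "G i"]) (simp add: G)
  have "AE x in LM L. H i x = G i x" for i
    by (rule weak_d2_unique[OF Lpos H[THEN conjunct1] G(1) H[THEN conjunct2] G(2)])
  then have "AE x in LM L. \<forall>i\<in>UNIV. H i x = G i x"
    by (rule AE_finite_allI[OF finite])
  then show ?thesis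
    by eventually_elim (simp add: lap_def H_def)
qed

lemma lap_weak:
  fixes L :: "real^'d"
  assumes f: "f \<in> H2per L"
  obtains G where "\<And>i. L2on L (G i)" "\<And>i. weak_d2 L f i i (G i)" "lap L f = (\<lambda>x. \<Sum>i\<in>UNIV. G i x)"
proof -
  have "L2on L (SOME g. L2on L g \<and> weak_d2 L f i i g) \<and> weak_d2 L f i i (SOME g. L2on L g \<and> weak_d2 L f i i g)" for i
    using someI_ex[OF H2perD(4)[OF f, of i i]] .
  then show ?thesis
    by (intro that[of "\<lambda>i. SOME g. L2on L g \<and> weak_d2 L f i i g"]) (auto simp: lap_def)
qed

lemma L2on_lap: "f \<in> H2per L \<Longrightarrow> L2on L (lap L f)"
  by (rule lap_weak[of f L]) (simp_all add: L2on_sum)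

lemma H2per_linear:
  assumes f: "f \<in> H2per L" and g: "g \<in> H2per L"
  shows "(\<lambda>x. a * f x + b * g x) \<in> H2per L"
proof -
  note L2 = H2perD(2)[OF f] H2perD(2)[OF g]
  have "per L (\<lambda>x. a * f x + b * g x)"
    using H2perD(1)[OF f] H2perD(1)[OF g] by (simp add: per_def)
  moreover have "\<exists>h. L2on L h \<and> weak_d1 L (\<lambda>x. a * f x + b * g x) i h" for i
  proof -
    obtain F G where FG: "L2on L F" "weak_d1 L f i F" "L2on L G" "weak_d1 L g i G"
      using H2perD(3)[OF f] H2perD(3)[OF g] by blast
    show ?thesis
      using weak_d1_linear[OF L2 FG(1,3,2,4)] L2on_linear[OF FG(1,3)] by blast
  qed
  moreover have "\<exists>h. L2on L h \<and> weak_d2 L (\<lambda>x. a * f x + b * g x) i j h" for i j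
  proof -
    obtain F G where FG: "L2on L F" "weak_d2 L f i j F" "L2on L G" "weak_d2 L g i j G"
      using H2perD(4)[OF f] H2perD(4)[OF g] by blast
    show ?thesis
      using weak_d2_linear[OF L2 FG(1,3,2,4)] L2on_linear[OF FG(1,3)] by blast
  qed
  ultimately show ?thesis using L2on_linear[OF L2] by (simp add: H2per_def)
qed

lemma lap_linear:
  fixes L :: "real^'d"
  assumes Lpos: "\<forall>i. 0 < L $ i" and f: "f \<in> H2per L" and g: "g \<in> H2per L"
  shows "AE x in LM L. lap L (\<lambda>x. a * f x + b * g x) x = a * lap L f x + b * lap L g x"
proof -
  obtain F where F: "\<And>i. L2on L (F i)" "\<And>i. weak_d2 L f i i (F i)" "lap L f = (\<lambda>x. \<Sum>i\<in>UNIV. F i x)"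
    using lap_weak[OF f] by metis
  obtain G where G: "\<And>i. L2on L (G i)" "\<And>i. weak_d2 L g i i (G i)" "lap L g = (\<lambda>x. \<Sum>i\<in>UNIV. G i x)"
    using lap_weak[OF g] by metis
  have "AE x in LM L. lap L (\<lambda>x. a * f x + b * g x) x = (\<Sum>i\<in>UNIV. a * F i x + b * G i x)"
    by (rule lap_eqI[OF Lpos L2on_linear[OF F(1) G(1)]
          weak_d2_linear[OF H2perD(2)[OF f] H2perD(2)[OF g] F(1) G(1) F(2) G(2)]])
  then show ?thesis
    by (simp add: F(3) G(3) sum.distrib sum_distrib_left)
qed

lemma H2per_diff: "f \<in> H2per L \<Longrightarrow> g \<in> H2per L \<Longrightarrow> (\<lambda>x. f x - g x) \<in> H2per L"
  using H2per_linear[of f L g 1 "-1"] by simp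

lemma lap_diff:
  assumes "\<forall>i. 0 < L $ i" "f \<in> H2per L" "g \<in> H2per L"
  shows "AE x in LM L. lap L (\<lambda>x. f x - g x) x = lap L f x - lap L g x"
  using lap_linear[OF assms, of 1 "-1"] by simp

lemma H2per_cmult: "f \<in> H2per L \<Longrightarrow> (\<lambda>x. c * f x) \<in> H2per L"
  using H2per_linear[of f L f c 0] by simp

lemma lap_cmult:
  assumes "\<forall>i. 0 < L $ i" "f \<in> H2per L"
  shows "AE x in LM L. lap L (\<lambda>x. c * f x) x = c * lap L f x"
  using lap_linear[OF assms assms(2), of c 0] by simp

subsection \<open>Translation invariance on the torus\<close>

text \<open>The Borel counterpart of \<open>LM\<close>, so that product measures and Fubini apply.\<close>

definition MO :: "real^'d \<Rightarrow> (real^'d) measure" where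
  "MO L = density lborel (indicator (Omega L))"

definition cell :: "real^'d \<Rightarrow> (real^'d) set" where
  "cell L = {x. \<forall>i. 0 \<le> x $ i \<and> x $ i < L $ i}"

definition lattice_pt :: "real^'d \<Rightarrow> int^'d \<Rightarrow> real^'d" where
  "lattice_pt L k = (\<chi> i. L $ i * of_int (k $ i))"

definition wrap :: "real^'d \<Rightarrow> real^'d \<Rightarrow> real^'d" where
  "wrap L x = (\<chi> i. x $ i - L $ i * of_int \<lfloor>x $ i / L $ i\<rfloor>)"

lemma sets_MO [measurable_cong, simp]: "sets (MO L) = sets borel"
  by (simp add: MO_def)

lemma space_MO [simp]: "space (MO L) = UNIV"
  by (simp add: MO_def)

lemma measurable_vec_nth [measurable]: "(\<lambda>x::real^'d. x $ i) \<in> borel_measurable borel"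
  by (intro borel_measurable_continuous_onI continuous_intros)

lemma cell_sets [measurable]: "cell L \<in> sets borel"
proof -
  have "cell L = (\<Inter>i\<in>UNIV. {x. 0 \<le> x $ i \<and> x $ i < L $ i})" by (auto simp: cell_def)
  also have "\<dots> \<in> sets borel"
  proof (rule sets.finite_INT)
    fix i
    have "{x \<in> space borel. 0 \<le> x $ i \<and> x $ i < L $ i} \<in> sets borel" by measurable
    then show "{x. 0 \<le> x $ i \<and> x $ i < L $ i} \<in> sets borel" by simp
  qed auto
  finally show ?thesis .
qed

lemma Omega_sets [measurable]: "Omega L \<in> sets borel"
  by (simp add: Omega_def)

lemma measurable_wrap [measurable]:
  fixes L :: "real^'d" shows "wrap L \<in> borel_measurable borel"
proof (rule borel_measurable_euclidean_space[THEN iffD2], intro ballI)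
  fix b :: "real^'d" assume "b \<in> Basis"
  then obtain i where b: "b = axis i 1" by (auto simp: Basis_vec_def)
  have "(\<lambda>x. x $ i - L $ i * of_int \<lfloor>x $ i / L $ i\<rfloor>) \<in> borel_measurable borel"
    by measurable
  then show "(\<lambda>x. wrap L x \<bullet> b) \<in> borel_measurable borel"
    unfolding b cart_eq_inner_axis[symmetric] wrap_def by simp
qed

lemma wrap_eq: "wrap L x = x + lattice_pt L (\<chi> i. - \<lfloor>x $ i / L $ i\<rfloor>)"
  by (simp add: wrap_def lattice_pt_def vec_eq_iff)

lemma wrap_in_cell:
  assumes "\<forall>i. 0 < L $ i" shows "wrap L x \<in> cell L"
proof -
  have "0 \<le> x $ i - L $ i * of_int \<lfloor>x $ i / L $ i\<rfloor> \<and> x $ i - L $ i * of_int \<lfloor>x $ i / L $ i\<rfloor> < L $ i" for i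
  proof -
    have Li: "0 < L $ i" using assms by simp
    have "L $ i * of_int \<lfloor>x $ i / L $ i\<rfloor> \<le> L $ i * (x $ i / L $ i)"
      "L $ i * (x $ i / L $ i) < L $ i * (of_int \<lfloor>x $ i / L $ i\<rfloor> + 1)"
      using Li by (intro mult_left_mono mult_strict_left_mono; simp)+
    then show ?thesis using Li by (simp add: distrib_left)
  qed
  then show ?thesis by (simp add: cell_def wrap_def)
qed

lemma floor_shift:
  assumes "\<forall>i. 0 < L $ i"
  shows "\<lfloor>(x + lattice_pt L k) $ i / L $ i\<rfloor> = \<lfloor>x $ i / L $ i\<rfloor> + k $ i"
proof -
  have "(x + lattice_pt L k) $ i / L $ i = x $ i / L $ i + of_int (k $ i)"
    using assms[rule_format, of i] by (simp add: lattice_pt_def field_simps)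
  then show ?thesis by (simp only: floor_add_int)
qed

lemma wrap_shift:
  assumes "\<forall>i. 0 < L $ i" shows "wrap L (x + lattice_pt L k) = wrap L x"
  unfolding wrap_def floor_shift[OF assms] by (simp add: vec_eq_iff lattice_pt_def algebra_simps)

lemma wrap_cell:
  assumes "\<forall>i. 0 < L $ i" "x \<in> cell L" shows "wrap L x = x"
proof -
  have "\<lfloor>x $ i / L $ i\<rfloor> = 0" for i
    using assms(2) assms(1)[rule_format, of i] by (simp add: floor_eq_iff cell_def)
  then show ?thesis by (simp add: wrap_def vec_eq_iff)
qed

lemma mem_cell_shift_iff:
  assumes "\<forall>i. 0 < L $ i"
  shows "x + lattice_pt L k \<in> cell L \<longleftrightarrow> k = (\<chi> i. - \<lfloor>x $ i / L $ i\<rfloor>)"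
proof
  assume "x + lattice_pt L k \<in> cell L"
  then have "\<lfloor>(x + lattice_pt L k) $ i / L $ i\<rfloor> = 0" for i
    using assms[rule_format, of i] unfolding floor_eq_iff cell_def by (simp add: field_simps)
  then have "\<lfloor>x $ i / L $ i\<rfloor> + k $ i = 0" for i
    unfolding floor_shift[OF assms] .
  then show "k = (\<chi> i. - \<lfloor>x $ i / L $ i\<rfloor>)"
    by (simp add: vec_eq_iff eq_neg_iff_add_eq_0 add.commute)
next
  assume "k = (\<chi> i. - \<lfloor>x $ i / L $ i\<rfloor>)"
  then show "x + lattice_pt L k \<in> cell L"
    using wrap_in_cell[OF assms, of x] by (simp add: wrap_eq)
qed

lemma nn_integral_cell:
  assumes "\<forall>i. 0 < L $ i"
  shows "(\<integral>\<^sup>+k. indicator (cell L) (x + lattice_pt L k) \<partial>count_space UNIV) = 1"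
    "(\<integral>\<^sup>+k. indicator (cell L) (x - lattice_pt L k) \<partial>count_space UNIV) = 1"
proof -
  define k0 where "k0 = (\<chi> i. - \<lfloor>x $ i / L $ i\<rfloor>)"
  have "indicator (cell L) (x + lattice_pt L k) = (indicator {k0} k :: ennreal)" for k
    unfolding indicator_def mem_cell_shift_iff[OF assms] k0_def[symmetric] by simp
  then show "(\<integral>\<^sup>+k. indicator (cell L) (x + lattice_pt L k) \<partial>count_space UNIV) = 1"
    by simp
  have m: "x - lattice_pt L k = x + lattice_pt L (- k)" for k
    by (simp add: lattice_pt_def vec_eq_iff)
  have "- k = k0 \<longleftrightarrow> k \<in> {- k0}" for k
    by auto
  then have "indicator (cell L) (x - lattice_pt L k) = (indicator {- k0} k :: ennreal)" for k
    unfolding indicator_def m mem_cell_shift_iff[OF assms] k0_def[symmetric] by presburger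
  then show "(\<integral>\<^sup>+k. indicator (cell L) (x - lattice_pt L k) \<partial>count_space UNIV) = 1"
    by simp
qed

lemma nn_integral_lborel_shift:
  fixes f :: "real^'d \<Rightarrow> ennreal"
  assumes [measurable]: "f \<in> borel_measurable borel"
  shows "(\<integral>\<^sup>+x. f (x + a) \<partial>lborel) = (\<integral>\<^sup>+x. f x \<partial>lborel)"
proof -
  have "(\<integral>\<^sup>+x. f x \<partial>lborel) = (\<integral>\<^sup>+x. f x \<partial>distr lborel borel ((+) a))"
    by (simp add: lborel_distr_plus)
  also have "\<dots> = (\<integral>\<^sup>+x. f (a + x) \<partial>lborel)"
    by (rule nn_integral_distr) auto
  finally show ?thesis by (simp add: add.commute)
qed

lemma MO_cell: "MO L = density lborel (indicator (cell L))"
  unfolding MO_def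
proof (rule density_cong)
  have "cbox 0 L - box 0 L \<in> null_sets lborel"
    using negligible_frontier_interval[of 0 L]
    by (simp add: negligible_iff_null_sets null_sets_completion_iff)
  from AE_not_in[OF this]
  show "AE x in lborel. indicator (Omega L) x = (indicator (cell L) x :: ennreal)"
  proof eventually_elim
    case (elim x)
    moreover have "x \<in> box 0 L \<Longrightarrow> x \<in> cell L" "x \<in> cell L \<Longrightarrow> x \<in> Omega L"
      by (auto simp: mem_box_cart cell_def mem_Omega less_imp_le)
    ultimately show ?case by (auto simp: Omega_def indicator_def)
  qed
qed simp_all

text \<open>The lattice translates of the cell tile the space; inserting the sum of their indicators on either
  side and exchanging sum and integral moves the translation by \<open>y\<close> from the integrand to the domain.\<close>

lemma distr_wrap_shift:
  fixes L y :: "real^'d"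
  assumes Lpos: "\<forall>i. 0 < L $ i"
  shows "distr (MO L) borel (\<lambda>x. wrap L (x + y)) = MO L"
proof (rule measure_eqI)
  fix A assume "A \<in> sets (distr (MO L) borel (\<lambda>x. wrap L (x + y)))"
  then have A [measurable]: "A \<in> sets borel" by simp
  let ?c = "\<lambda>x. indicator (cell L) x :: ennreal"
  let ?A = "\<lambda>x. indicator A (wrap L x) :: ennreal"
  have "emeasure (distr (MO L) borel (\<lambda>x. wrap L (x + y))) A = (\<integral>\<^sup>+x. indicator A x \<partial>distr (MO L) borel (\<lambda>x. wrap L (x + y)))"
    by simp
  also have "\<dots> = (\<integral>\<^sup>+x. ?A (x + y) \<partial>MO L)"
    by (subst nn_integral_distr) auto
  also have "\<dots> = (\<integral>\<^sup>+x. ?c x * ?A (x + y) \<partial>lborel)"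
    unfolding MO_cell by (subst nn_integral_density) auto
  also have "\<dots> = (\<integral>\<^sup>+x. ?c (x - y) * ?A x \<partial>lborel)"
    using nn_integral_lborel_shift[of "\<lambda>x. ?c (x - y) * ?A x" y] by simp
  also have "\<dots> = (\<integral>\<^sup>+x. (\<integral>\<^sup>+k. ?c (x + lattice_pt L k) * (?c (x - y) * ?A x) \<partial>count_space UNIV) \<partial>lborel)"
    by (simp add: nn_integral_multc nn_integral_cell[OF Lpos])
  also have "\<dots> = (\<integral>\<^sup>+k. (\<integral>\<^sup>+x. ?c (x + lattice_pt L k) * (?c (x - y) * ?A x) \<partial>lborel) \<partial>count_space UNIV)"
    by (rule nn_integral_count_space_nn_integral) auto
  also have "\<dots> = (\<integral>\<^sup>+k. (\<integral>\<^sup>+x. ?c x * (?c ((x - y) - lattice_pt L k) * ?A x) \<partial>lborel) \<partial>count_space UNIV)"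
  proof (rule nn_integral_cong)
    fix k :: "int^'d"
    have "(\<integral>\<^sup>+x. ?c x * (?c ((x - y) - lattice_pt L k) * ?A x) \<partial>lborel)
        = (\<integral>\<^sup>+x. ?c (x + lattice_pt L k) * (?c ((x + lattice_pt L k) - y - lattice_pt L k) * ?A (x + lattice_pt L k)) \<partial>lborel)"
      by (rule nn_integral_lborel_shift[symmetric]) measurable
    then show "(\<integral>\<^sup>+x. ?c (x + lattice_pt L k) * (?c (x - y) * ?A x) \<partial>lborel)
       = (\<integral>\<^sup>+x. ?c x * (?c ((x - y) - lattice_pt L k) * ?A x) \<partial>lborel)"
      by (simp add: wrap_shift[OF Lpos] algebra_simps)
  qed
  also have "\<dots> = (\<integral>\<^sup>+x. (\<integral>\<^sup>+k. ?c x * (?c ((x - y) - lattice_pt L k) * ?A x) \<partial>count_space UNIV) \<partial>lborel)"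
    by (rule nn_integral_count_space_nn_integral[symmetric]) auto
  also have "\<dots> = (\<integral>\<^sup>+x. ?c x * ?A x \<partial>lborel)"
    by (simp add: nn_integral_multc nn_integral_cmult nn_integral_cell[OF Lpos])
  also have "\<dots> = (\<integral>\<^sup>+x. ?c x * indicator A x \<partial>lborel)"
    by (intro nn_integral_cong) (auto simp: indicator_def wrap_cell[OF Lpos])
  also have "\<dots> = emeasure (MO L) A"
    unfolding MO_cell by (simp add: emeasure_density)
  finally show "emeasure (distr (MO L) borel (\<lambda>x. wrap L (x + y))) A = emeasure (MO L) A" .
qed simp

lemma per_int_shift:
  assumes "per L F" shows "F (x + axis i (L $ i * of_int k)) = F x"
proof (induction k arbitrary: x rule: int_induct[where k=0])
  case (step1 m)
  have "axis i (L $ i * of_int (m + 1)) = axis i (L $ i * of_int m) + axis i (L $ i)"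
    by (simp add: axis_def vec_eq_iff algebra_simps)
  then show ?case
    using step1(2)[of x] assms unfolding per_def by (metis add.assoc)
next
  case (step2 m)
  have "axis i (L $ i * of_int m) = axis i (L $ i * of_int (m - 1)) + axis i (L $ i)"
    by (simp add: axis_def vec_eq_iff algebra_simps)
  then show ?case
    using step2(2)[of x] assms unfolding per_def by (metis add.assoc)
qed (simp add: axis_def zero_vec_def[symmetric])

lemma per_lattice:
  fixes L :: "real^'d"
  assumes "per L F" shows "F (x + lattice_pt L k) = F x"
proof -
  have "F (x + (\<Sum>i\<in>I. axis i (L $ i * of_int (k $ i)))) = F x" if "finite I" for I
    using that
  proof (induction I arbitrary: x rule: finite_induct)
    case (insert j I)
    have "F (x + (\<Sum>i\<in>insert j I. axis i (L $ i * of_int (k $ i))))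
        = F ((x + axis j (L $ j * of_int (k $ j))) + (\<Sum>i\<in>I. axis i (L $ i * of_int (k $ i))))"
      using insert(1,2) by (simp add: add.assoc)
    also have "\<dots> = F x"
      using insert(3) per_int_shift[OF assms] by metis
    finally show ?case .
  qed simp
  moreover have "lattice_pt L k = (\<Sum>i\<in>UNIV. axis i (L $ i * of_int (k $ i)))"
    by (simp add: vec_eq_iff lattice_pt_def axis_def sum_component)
  ultimately show ?thesis by simp
qed

lemma per_wrap: "per L F \<Longrightarrow> F (wrap L x) = F x"
  by (simp add: wrap_eq per_lattice)

lemma per_comp_wrap:
  assumes "\<forall>i. 0 < L $ i" shows "per L (\<lambda>x. F (wrap L x))"
  unfolding per_def
proof safe
  fix x i
  have "axis i (L $ i) = lattice_pt L (axis i 1)"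
    by (simp add: lattice_pt_def axis_def vec_eq_iff)
  then show "F (wrap L (x + axis i (L $ i))) = F (wrap L x)"
    using wrap_shift[OF assms, of x "axis i 1"] by simp
qed

lemma MO_shift:
  fixes F :: "real^'d \<Rightarrow> real"
  assumes Lpos: "\<forall>i. 0 < L $ i" and F [measurable]: "F \<in> borel_measurable borel" and per: "per L F"
  shows "integral\<^sup>L (MO L) (\<lambda>x. F (x + y)) = integral\<^sup>L (MO L) F"
    "integrable (MO L) (\<lambda>x. F (x + y)) \<longleftrightarrow> integrable (MO L) F"
proof -
  have eq: "(\<lambda>x. F (x + y)) = (\<lambda>x. F (wrap L (x + y)))" by (simp add: per_wrap[OF per])
  have "integral\<^sup>L (distr (MO L) borel (\<lambda>x. wrap L (x + y))) F = integral\<^sup>L (MO L) (\<lambda>x. F (wrap L (x + y)))"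
    by (rule integral_distr) measurable
  then show "integral\<^sup>L (MO L) (\<lambda>x. F (x + y)) = integral\<^sup>L (MO L) F"
    unfolding eq distr_wrap_shift[OF Lpos] by simp
  have "integrable (distr (MO L) borel (\<lambda>x. wrap L (x + y))) F \<longleftrightarrow> integrable (MO L) (\<lambda>x. F (wrap L (x + y)))"
    by (rule integrable_distr_eq) measurable
  then show "integrable (MO L) (\<lambda>x. F (x + y)) \<longleftrightarrow> integrable (MO L) F"
    unfolding eq distr_wrap_shift[OF Lpos] by simp
qed

lemma MO_LM:
  fixes F :: "real^'d \<Rightarrow> real"
  assumes F [measurable]: "F \<in> borel_measurable borel"
  shows "integral\<^sup>L (MO L) F = intO L F" "integrable (MO L) F \<longleftrightarrow> integrable (LM L) F"
proof -
  have m: "(\<lambda>x. indicator (Omega L) x * F x) \<in> borel_measurable lborel" by simp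
  have MO: "MO L = density lborel (\<lambda>x. ennreal (indicator (Omega L) x))"
    unfolding MO_def by (rule density_cong) (auto simp: indicator_def)
  show "integral\<^sup>L (MO L) F = intO L F"
    unfolding MO intO_def
    by (subst integral_density) (auto simp: integral_restrict_space Omega_lmeasurable integral_completion[OF m])
  show "integrable (MO L) F \<longleftrightarrow> integrable (LM L) F"
    unfolding MO integrable_LM_iff
    by (subst integrable_density) (auto simp: integrable_completion[OF m])
qed

lemma finite_measure_MO: "finite_measure (MO L)"
  by (rule finite_measureI) (simp add: MO_def emeasure_density Omega_def emeasure_lborel_cbox_eq)

lemma periodic_rep:
  fixes L :: "real^'d"
  assumes Lpos: "\<forall>i. 0 < L $ i" and f: "f \<in> borel_measurable (LM L)"
  obtains F :: "real^'d \<Rightarrow> real" where "F \<in> borel_measurable borel" "per L F" "AE x in LM L. f x = F x"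
proof -
  have "(\<lambda>x. indicator (Omega L) x *\<^sub>R f x) \<in> borel_measurable (completion lborel)"
    using f by (subst (asm) borel_measurable_restrict_space_iff) (auto simp: Omega_lmeasurable)
  from completion_ex_borel_measurable_real[OF this[simplified]]
  obtain F0 where F0: "F0 \<in> borel_measurable lborel" "AE x in lborel. indicator (Omega L) x * f x = F0 x"
    by auto
  have [measurable]: "F0 \<in> borel_measurable borel" using F0(1) by simp
  have "AE x in LM L. x \<in> Omega L"
    by (rule AE_I2) simp
  moreover have "AE x in LM L. indicator (Omega L) x * f x = F0 x"
    using AE_completion[OF F0(2)] by (subst AE_restrict_space_iff) (auto simp: Omega_lmeasurable)
  ultimately have "AE x in LM L. f x = F0 (wrap L x)"
    using AE_LM_box[of L]
  proof eventually_elim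
    case (elim x)
    have "x \<in> cell L" using elim(3) by (auto simp: mem_box_cart cell_def less_imp_le)
    then show ?case using elim by (simp add: wrap_cell[OF Lpos])
  qed
  moreover have "(\<lambda>x. F0 (wrap L x)) \<in> borel_measurable borel" by measurable
  ultimately show ?thesis using per_comp_wrap[OF Lpos, of F0] that by blast
qed

lemma has_derivative_along_axis:
  fixes v :: "real^'d \<Rightarrow> real"
  assumes "\<And>x. v differentiable (at x)"
  shows "((\<lambda>t. v (x + axis i t)) has_real_derivative pdiff i v (x + axis i t)) (at t)"
proof -
  have ax: "s *\<^sub>R (axis i 1 :: real^'d) = axis i s" for s
    by (simp add: axis_def vec_eq_iff)
  have "((\<lambda>t. x + t *\<^sub>R axis i 1) has_derivative (\<lambda>s. s *\<^sub>R axis i 1)) (at t)"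
    by (auto intro!: derivative_eq_intros)
  then have 1: "((\<lambda>t. x + axis i t) has_derivative (\<lambda>s. axis i s)) (at t)"
    unfolding ax .
  have "linear (frechet_derivative v (at (x + axis i t)))"
    using assms by (rule linear_frechet_derivative)
  then have "frechet_derivative v (at (x + axis i t)) (s *\<^sub>R axis i 1) = s * pdiff i v (x + axis i t)" for s
    unfolding pdiff_def by (simp add: linear_scale)
  then have "frechet_derivative v (at (x + axis i t)) (axis i s) = s * pdiff i v (x + axis i t)" for s
    unfolding ax .
  with has_derivative_compose[OF 1 assms[of "x + axis i t", unfolded frechet_derivative_works]]
  show ?thesis unfolding has_field_derivative_def by (simp add: mult.commute[of _ "pdiff i v (x + axis i t)"])
qed

lemma intO_pdiff_zero:
  fixes L :: "real^'d"
  assumes Lpos: "\<forall>i. 0 < L $ i" and v: "per L v" "\<And>x. v differentiable (at x)" "continuous_on UNIV (pdiff i v)"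
  shows "intO L (pdiff i v) = 0"
proof -
  define D where "D n x = (v (x + axis i (1 / real (Suc n))) - v x) / (1 / real (Suc n))" for n and x :: "real^'d"
  have cv: "continuous_on UNIV v"
    using v(2) by (intro continuous_at_imp_continuous_on ballI differentiable_imp_continuous_within)
  then have vm [measurable]: "v \<in> borel_measurable borel" by (rule borel_measurable_continuous_onI)
  have pm [measurable]: "pdiff i v \<in> borel_measurable borel" by (rule borel_measurable_continuous_onI[OF v(3)])
  obtain B where B: "0 \<le> B" "\<And>x. x \<in> Omega L \<Longrightarrow> \<bar>pdiff i v x\<bar> \<le> B"
    using continuous_bounded_Omega[OF v(3), of L] by metis
  have B': "\<bar>pdiff i v x\<bar> \<le> B" for x
  proof -
    have "wrap L x \<in> Omega L" using wrap_in_cell[OF Lpos, of x] by (auto simp: cell_def mem_Omega less_imp_le)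
    then show ?thesis using B(2) per_wrap[OF per_pdiff[OF v(1,2)], of i x] by metis
  qed
  have iv: "integrable (MO L) v"
    unfolding MO_LM[OF vm] by (intro L2on_integrable L2on_continuous cv)
  have "(\<lambda>n. integral\<^sup>L (MO L) (D n)) \<longlonglongrightarrow> integral\<^sup>L (MO L) (pdiff i v)"
  proof (rule integral_dominated_convergence[where w="\<lambda>_. B"])
    show "pdiff i v \<in> borel_measurable (MO L)" "D n \<in> borel_measurable (MO L)" for n
      unfolding D_def by measurable
    show "integrable (MO L) (\<lambda>_. B)"
      by (rule finite_measure.integrable_const[OF finite_measure_MO])
    have "(\<lambda>n. D n x) \<longlonglongrightarrow> pdiff i v x" for x
    proof -
      have "((\<lambda>h. (v (x + axis i (0 + h)) - v (x + axis i 0)) / h) \<longlongrightarrow> pdiff i v (x + axis i 0)) (at 0)"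
        using has_derivative_along_axis[OF v(2), of x i 0] unfolding DERIV_def .
      moreover have "filterlim (\<lambda>n. 1 / real (Suc n)) (at 0) sequentially"
        using LIMSEQ_inverse_real_of_nat by (auto simp: filterlim_at inverse_eq_divide)
      ultimately have "(\<lambda>n. (v (x + axis i (0 + 1 / real (Suc n))) - v (x + axis i 0)) / (1 / real (Suc n))) \<longlonglongrightarrow> pdiff i v (x + axis i 0)"
        by (rule filterlim_compose)
      then show ?thesis
        by (simp add: D_def axis_def zero_vec_def[symmetric])
    qed
    then show "AE x in MO L. (\<lambda>n. D n x) \<longlonglongrightarrow> pdiff i v x" by simp
    have "\<bar>D n x\<bar> \<le> B" for n x
    proof -
      have "\<exists>z. 0 < z \<and> z < 1 / real (Suc n) \<and> v (x + axis i (1 / real (Suc n))) - v (x + axis i 0)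
          = (1 / real (Suc n) - 0) * pdiff i v (x + axis i z)"
        by (rule MVT2) (auto intro: has_derivative_along_axis[OF v(2)])
      then obtain z where "v (x + axis i (1 / real (Suc n))) - v (x + axis i 0) = (1 / real (Suc n) - 0) * pdiff i v (x + axis i z)"
        by blast
      then have "D n x = pdiff i v (x + axis i z)"
        by (simp add: D_def axis_def zero_vec_def[symmetric])
      then show ?thesis using B' by simp
    qed
    then show "AE x in MO L. norm (D n x) \<le> B" for n by simp
  qed
  moreover have "integral\<^sup>L (MO L) (D n) = 0" for n
    unfolding D_def using MO_shift[OF Lpos vm v(1), of "axis i (1 / real (Suc n))"] iv
    by (simp add: Bochner_Integration.integral_diff)
  ultimately have "integral\<^sup>L (MO L) (pdiff i v) = 0"
    by (simp add: LIMSEQ_const_iff)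
  then show ?thesis by (simp add: MO_LM[OF pm])
qed

lemma const_weak_derivs:
  fixes L :: "real^'d"
  assumes Lpos: "\<forall>i. 0 < L $ i"
  shows "weak_d1 L (\<lambda>x. c) i (\<lambda>x. 0)" "weak_d2 L (\<lambda>x. c) i j (\<lambda>x. 0)"
proof -
  show "weak_d1 L (\<lambda>x. c) i (\<lambda>x. 0)"
    unfolding weak_d1_def
  proof (intro allI impI)
    fix v assume v: "test_fun L v"
    have "intO L (pdiff i v) = 0"
      using test_fun_facts[OF v] by (intro intO_pdiff_zero[OF Lpos])
    then show "intO L (\<lambda>x. c * pdiff i v x) = - intO L (\<lambda>x. 0 * v x)"
      by (simp add: intO_def)
  qed
  show "weak_d2 L (\<lambda>x. c) i j (\<lambda>x. 0)"
    unfolding weak_d2_def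
  proof (intro allI impI)
    fix v assume v: "test_fun L v"
    have "intO L (pdiff j (pdiff i v)) = 0"
      using test_fun_facts[OF v] by (intro intO_pdiff_zero[OF Lpos])
    then show "intO L (\<lambda>x. c * pdiff j (pdiff i v) x) = intO L (\<lambda>x. 0 * v x)"
      by (simp add: intO_def)
  qed
qed

lemma H2per_const:
  assumes Lpos: "\<forall>i. 0 < L $ i" shows "(\<lambda>x. c) \<in> H2per L"
  using const_weak_derivs[OF assms, of c] L2on_const[of L] unfolding H2per_def
  by (auto simp: per_def intro!: exI[of _ "\<lambda>x. 0"])

lemma lap_const:
  assumes Lpos: "\<forall>i. 0 < L $ i" shows "AE x in LM L. lap L (\<lambda>x. c) x = 0"
  using lap_eqI[OF Lpos L2on_const const_weak_derivs(2)[OF Lpos]] by simp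

lemma intO_lap:
  fixes L :: "real^'d"
  assumes "f \<in> H2per L" shows "intO L (lap L f) = 0"
proof -
  obtain G where G: "\<And>i. L2on L (G i)" "\<And>i. weak_d2 L f i i (G i)" "lap L f = (\<lambda>x. \<Sum>i\<in>UNIV. G i x)"
    using lap_weak[OF assms] by metis
  have "intO L (\<lambda>x. G i x * 1) = 0" for i
    using G(2)[of i, unfolded weak_d2_def, rule_format, OF test_fun_const[of L 1]]
    by (simp add: pdiff_const intO_def)
  then show ?thesis
    using L2on_integrable[OF G(1)] by (simp add: G(3) intO_def)
qed

subsection \<open>Periodic mollification\<close>

definition moll :: "real^'d \<Rightarrow> (real^'d \<Rightarrow> real) \<Rightarrow> (real^'d \<Rightarrow> real) \<Rightarrow> real^'d \<Rightarrow> real" where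
  "moll L g F x = (\<integral>y. F (x + y) * g y \<partial>MO L)"

lemma sigma_finite_MO: "sigma_finite_measure (MO L)"
  using finite_measure_MO[of L] by (rule finite_measure.axioms(1))

lemma pair_sigma_finite_MO: "pair_sigma_finite (MO L) (MO L)"
  by (simp add: pair_sigma_finite_def sigma_finite_MO)

locale mollifier =
  fixes L :: "real^'d" and g :: "real^'d \<Rightarrow> real" and B :: real
  assumes Lpos: "\<forall>i. 0 < L $ i" and g_meas [measurable]: "g \<in> borel_measurable borel"
    and g_nonneg: "\<And>x. 0 \<le> g x" and g_le: "\<And>x. g x \<le> B" and g_int: "integral\<^sup>L (MO L) g = 1"
begin

lemma integrable_g: "integrable (MO L) g"
  using g_nonneg g_le
  by (intro finite_measure.integrable_const_bound[OF finite_measure_MO, where B=B]) auto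

lemma integrable_shift:
  assumes F [measurable]: "F \<in> borel_measurable borel" and "per L F" "integrable (MO L) F"
  shows "integrable (MO L) (\<lambda>y. F (x + y))" "integral\<^sup>L (MO L) (\<lambda>y. F (x + y)) = integral\<^sup>L (MO L) F"
  using MO_shift[OF Lpos assms(1,2), of x] assms(3) by (simp_all add: add.commute)

lemma integrable_moll:
  assumes F [measurable]: "F \<in> borel_measurable borel" and "per L F" "integrable (MO L) F"
  shows "integrable (MO L) (\<lambda>y. F (x + y) * g y)"
proof (rule Bochner_Integration.integrable_bound)
  show "integrable (MO L) (\<lambda>y. B * F (x + y))"
    by (intro integrable_mult_right integrable_shift assms)
  show "AE y in MO L. norm (F (x + y) * g y) \<le> norm (B * F (x + y))"
  proof (rule AE_I2)
    fix y
    have "\<bar>g y\<bar> \<le> \<bar>B\<bar>" using g_nonneg[of y] g_le[of y] by linarith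
    then have "\<bar>F (x + y)\<bar> * \<bar>g y\<bar> \<le> \<bar>F (x + y)\<bar> * \<bar>B\<bar>" by (intro mult_left_mono) auto
    then show "norm (F (x + y) * g y) \<le> norm (B * F (x + y))" by (simp add: abs_mult mult.commute)
  qed
qed measurable

lemma moll_bound:
  assumes F [measurable]: "F \<in> borel_measurable borel" and "per L F" "integrable (MO L) F"
  shows "(\<integral>y. \<bar>F (x + y) * g y\<bar> \<partial>MO L) \<le> B * (\<integral>y. \<bar>F y\<bar> \<partial>MO L)"
    "\<bar>moll L g F x\<bar> \<le> B * (\<integral>y. \<bar>F y\<bar> \<partial>MO L)"
proof -
  have m: "(\<lambda>y. \<bar>F y\<bar>) \<in> borel_measurable borel" by measurable
  have p: "per L (\<lambda>y. \<bar>F y\<bar>)" using assms(2) by (simp add: per_def)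
  have i: "integrable (MO L) (\<lambda>y. \<bar>F y\<bar>)" using assms(3) by simp
  have "(\<integral>y. \<bar>F (x + y) * g y\<bar> \<partial>MO L) \<le> (\<integral>y. B * \<bar>F (x + y)\<bar> \<partial>MO L)"
  proof (rule integral_mono)
    show "integrable (MO L) (\<lambda>y. \<bar>F (x + y) * g y\<bar>)"
      by (intro integrable_abs integrable_moll assms)
    show "integrable (MO L) (\<lambda>y. B * \<bar>F (x + y)\<bar>)"
      by (intro integrable_mult_right integrable_shift(1)[OF m p i])
    fix y
    have "\<bar>F (x + y)\<bar> * g y \<le> \<bar>F (x + y)\<bar> * B" by (intro mult_left_mono g_le) auto
    then show "\<bar>F (x + y) * g y\<bar> \<le> B * \<bar>F (x + y)\<bar>"
      using g_nonneg[of y] by (simp add: abs_mult mult.commute)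
  qed
  also have "\<dots> = B * (\<integral>y. \<bar>F y\<bar> \<partial>MO L)"
    using integrable_shift(2)[OF m p i] by simp
  finally show *: "(\<integral>y. \<bar>F (x + y) * g y\<bar> \<partial>MO L) \<le> B * (\<integral>y. \<bar>F y\<bar> \<partial>MO L)" .
  show "\<bar>moll L g F x\<bar> \<le> B * (\<integral>y. \<bar>F y\<bar> \<partial>MO L)"
    unfolding moll_def by (rule order_trans[OF integral_abs_bound *])
qed

lemma measurable_moll [measurable]:
  assumes [measurable]: "F \<in> borel_measurable borel"
  shows "moll L g F \<in> borel_measurable borel"
proof -
  have "(\<lambda>x. \<integral>y. F (x + y) * g y \<partial>MO L) \<in> borel_measurable borel"
    by (rule sigma_finite_measure.borel_measurable_lebesgue_integral[OF sigma_finite_MO]) measurable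
  then show ?thesis unfolding moll_def[abs_def] .
qed

lemma per_moll:
  assumes "per L F" shows "per L (moll L g F)"
proof -
  have "F (x + axis i (L $ i) + y) = F (x + y)" for x y i
    using assms unfolding per_def by (metis add.assoc add.commute)
  then show ?thesis by (simp add: per_def moll_def)
qed

lemma moll_L2on:
  assumes F: "F \<in> borel_measurable borel" "per L F" "integrable (MO L) F"
  shows "L2on L (moll L g F)"
  using moll_bound(2)[OF F] by (intro L2on_bounded measurable_LM measurable_moll F AE_I2)

lemma moll_Fubini:
  assumes F [measurable]: "F \<in> borel_measurable borel" and Fp: "per L F" and Fi: "integrable (MO L) F"
    and p [measurable]: "p \<in> borel_measurable borel" and pp: "per L p" and pb: "\<And>x. \<bar>p x\<bar> \<le> C"
  shows "(\<integral>x. moll L g F x * p x \<partial>MO L) = (\<integral>y. g y * (\<integral>x. F x * p (x - y) \<partial>MO L) \<partial>MO L)"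
proof -
  interpret P: pair_sigma_finite "MO L" "MO L" by (rule pair_sigma_finite_MO)
  define f where "f x y = F (x + y) * g y * p x" for x y
  have f_meas [measurable]: "case_prod f \<in> borel_measurable (MO L \<Otimes>\<^sub>M MO L)"
    unfolding f_def by measurable
  have "integrable (MO L \<Otimes>\<^sub>M MO L) (case_prod f)"
  proof (rule P.Fubini_integrable)
    show "AE x in MO L. integrable (MO L) (\<lambda>y. case (x, y) of (x, y) \<Rightarrow> f x y)"
      using integrable_moll[OF F Fp Fi] by (intro AE_I2) (simp add: f_def)
    show "integrable (MO L) (\<lambda>x. \<integral>y. norm (case (x, y) of (x, y) \<Rightarrow> f x y) \<partial>MO L)"
    proof (rule finite_measure.integrable_const_bound[OF finite_measure_MO, where B="(B * (\<integral>y. \<bar>F y\<bar> \<partial>MO L)) * C"])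
      show "AE x in MO L. norm (\<integral>y. norm (case (x, y) of (x, y) \<Rightarrow> f x y) \<partial>MO L) \<le> B * (\<integral>y. \<bar>F y\<bar> \<partial>MO L) * C"
      proof (rule AE_I2)
        fix x
        have "(\<integral>y. norm (f x y) \<partial>MO L) = (\<integral>y. \<bar>F (x + y) * g y\<bar> \<partial>MO L) * \<bar>p x\<bar>"
          by (simp add: f_def abs_mult)
        also have "\<dots> \<le> (B * (\<integral>y. \<bar>F y\<bar> \<partial>MO L)) * C"
          using moll_bound[OF F Fp Fi, of x] by (intro mult_mono pb) auto
        finally show "norm (\<integral>y. norm (case (x, y) of (x, y) \<Rightarrow> f x y) \<partial>MO L) \<le> B * (\<integral>y. \<bar>F y\<bar> \<partial>MO L) * C"
          by simp
      qed
      show "(\<lambda>x. \<integral>y. norm (case (x, y) of (x, y) \<Rightarrow> f x y) \<partial>MO L) \<in> borel_measurable (MO L)"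
        by (rule sigma_finite_measure.borel_measurable_lebesgue_integral[OF sigma_finite_MO]) measurable
    qed
  qed measurable
  then have "(\<integral>y. (\<integral>x. f x y \<partial>MO L) \<partial>MO L) = (\<integral>x. (\<integral>y. f x y \<partial>MO L) \<partial>MO L)"
    by (rule P.Fubini_integral)
  also have "(\<lambda>x. \<integral>y. f x y \<partial>MO L) = (\<lambda>x. moll L g F x * p x)"
    by (simp add: f_def moll_def)
  also have "(\<lambda>y. \<integral>x. f x y \<partial>MO L) = (\<lambda>y. g y * (\<integral>x. F x * p (x - y) \<partial>MO L))"
  proof
    fix y
    have "(\<lambda>x. F x * p (x - y)) \<in> borel_measurable borel" by measurable
    moreover have "per L (\<lambda>x. F x * p (x - y))"
      using Fp pp unfolding per_def by (metis add_diff_eq add.commute diff_add_eq)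
    ultimately have "(\<integral>x. F (x + y) * p (x + y - y) \<partial>MO L) = (\<integral>x. F x * p (x - y) \<partial>MO L)"
      by (rule MO_shift[OF Lpos])
    moreover have "(\<integral>x. f x y \<partial>MO L) = (\<integral>x. g y * (F (x + y) * p x) \<partial>MO L)"
      by (simp add: f_def mult_ac)
    ultimately show "(\<integral>x. f x y \<partial>MO L) = g y * (\<integral>x. F x * p (x - y) \<partial>MO L)" by simp
  qed
  finally show ?thesis by simp
qed

lemma moll_L2_contraction:
  assumes F [measurable]: "F \<in> borel_measurable borel" and Fp: "per L F" and Fi: "integrable (MO L) F"
    and F2: "integrable (MO L) (\<lambda>x. (F x)\<^sup>2)"
  shows "(\<integral>x. (moll L g F x)\<^sup>2 \<partial>MO L) \<le> (\<integral>x. (F x)\<^sup>2 \<partial>MO L)"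
proof -
  have m2: "(\<lambda>x. (F x)\<^sup>2) \<in> borel_measurable borel" by measurable
  have p2: "per L (\<lambda>x. (F x)\<^sup>2)" using Fp by (simp add: per_def)
  have le: "(moll L g F x)\<^sup>2 \<le> moll L g (\<lambda>x. (F x)\<^sup>2) x" for x
  proof -
    define m where "m = moll L g F x"
    note i = integrable_moll[OF F Fp Fi, of x] integrable_moll[OF m2 p2 F2, of x] integrable_g
    have "0 \<le> (\<integral>y. (F (x + y) - m)\<^sup>2 * g y \<partial>MO L)"
      by (intro Bochner_Integration.integral_nonneg mult_nonneg_nonneg g_nonneg) auto
    also have "(\<lambda>y. (F (x + y) - m)\<^sup>2 * g y) = (\<lambda>y. (F (x + y))\<^sup>2 * g y - 2 * m * (F (x + y) * g y) + m\<^sup>2 * g y)"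
      by (simp add: power2_eq_square algebra_simps)
    also have "(\<integral>y. (F (x + y))\<^sup>2 * g y - 2 * m * (F (x + y) * g y) + m\<^sup>2 * g y \<partial>MO L)
       = moll L g (\<lambda>x. (F x)\<^sup>2) x - 2 * m * m + m\<^sup>2"
      using i by (simp add: g_int moll_def m_def)
    finally show ?thesis by (simp add: m_def power2_eq_square)
  qed
  have "(\<integral>x. (moll L g F x)\<^sup>2 \<partial>MO L) \<le> (\<integral>x. moll L g (\<lambda>x. (F x)\<^sup>2) x * 1 \<partial>MO L)"
  proof (rule integral_mono)
    show "integrable (MO L) (\<lambda>x. (moll L g F x)\<^sup>2)"
      using L2onD(2)[OF moll_L2on[OF F Fp Fi]] MO_LM(2)[of "\<lambda>x. (moll L g F x)\<^sup>2" L] by simp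
    show "integrable (MO L) (\<lambda>x. moll L g (\<lambda>x. (F x)\<^sup>2) x * 1)"
      using L2on_integrable[OF moll_L2on[OF m2 p2 F2]] MO_LM(2)[of "moll L g (\<lambda>x. (F x)\<^sup>2)" L] by simp
  qed (use le in simp)
  also have "\<dots> = (\<integral>y. g y * (\<integral>x. (F x)\<^sup>2 * 1 \<partial>MO L) \<partial>MO L)"
    by (rule moll_Fubini[OF m2 p2 F2, where p="\<lambda>_. 1" and C=1]) (auto simp: per_def)
  also have "\<dots> = (\<integral>x. (F x)\<^sup>2 \<partial>MO L)" by (simp add: g_int)
  finally show ?thesis .
qed

lemma moll_add:
  assumes F: "F \<in> borel_measurable borel" "per L F" "integrable (MO L) F"
    and G: "G \<in> borel_measurable borel" "per L G" "integrable (MO L) G"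
  shows "moll L g (\<lambda>x. F x + G x) x = moll L g F x + moll L g G x"
  using integrable_moll[OF F, of x] integrable_moll[OF G, of x] by (simp add: moll_def distrib_right)

lemma moll_sum:
  assumes "finite I" and F: "\<And>i. i \<in> I \<Longrightarrow> F i \<in> borel_measurable borel" "\<And>i. i \<in> I \<Longrightarrow> per L (F i)"
     "\<And>i. i \<in> I \<Longrightarrow> integrable (MO L) (F i)"
  shows "moll L g (\<lambda>x. \<Sum>i\<in>I. F i x) x = (\<Sum>i\<in>I. moll L g (F i) x)"
proof -
  have "moll L g (\<lambda>x. \<Sum>i\<in>I. F i x) x = (\<integral>y. (\<Sum>i\<in>I. F i (x + y) * g y) \<partial>MO L)"
    by (simp add: moll_def sum_distrib_right)
  also have "\<dots> = (\<Sum>i\<in>I. moll L g (F i) x)"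
    unfolding moll_def by (rule Bochner_Integration.integral_sum) (rule integrable_moll[OF F])
  finally show ?thesis .
qed

lemma test_pairing_moll:
  assumes F: "F \<in> borel_measurable borel" "per L F" "integrable (MO L) F"
    and p: "continuous_on UNIV p" "per L p"
  shows "intO L (\<lambda>x. moll L g F x * p x) = (\<integral>y. g y * intO L (\<lambda>x. F x * p (x - y)) \<partial>MO L)"
proof -
  have pm [measurable]: "p \<in> borel_measurable borel" by (rule borel_measurable_continuous_onI[OF p(1)])
  note [measurable] = F(1)
  obtain C where C: "\<And>x. x \<in> Omega L \<Longrightarrow> \<bar>p x\<bar> \<le> C"
    using continuous_bounded_Omega[OF p(1), of L] by metis
  have C': "\<bar>p x\<bar> \<le> C" for x
  proof -
    have "wrap L x \<in> Omega L" using wrap_in_cell[OF Lpos, of x] by (auto simp: cell_def mem_Omega less_imp_le)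
    then show ?thesis using C per_wrap[OF p(2), of x] by metis
  qed
  have "intO L (\<lambda>x. moll L g F x * p x) = (\<integral>x. moll L g F x * p x \<partial>MO L)"
    by (rule MO_LM(1)[symmetric]) measurable
  also have "\<dots> = (\<integral>y. g y * (\<integral>x. F x * p (x - y) \<partial>MO L) \<partial>MO L)"
    by (rule moll_Fubini[OF F pm p(2) C'])
  also have "(\<lambda>y. \<integral>x. F x * p (x - y) \<partial>MO L) = (\<lambda>y. intO L (\<lambda>x. F x * p (x - y)))"
    by (intro ext MO_LM(1)) measurable
  finally show ?thesis .
qed

lemma weak_d1_moll:
  assumes F: "F \<in> borel_measurable borel" "per L F" "integrable (MO L) F"
    and G: "G \<in> borel_measurable borel" "per L G" "integrable (MO L) G"
    and w: "weak_d1 L F i G"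
  shows "weak_d1 L (moll L g F) i (moll L g G)"
  unfolding weak_d1_def
proof (intro allI impI)
  fix v assume v: "test_fun L v"
  note tf = test_fun_facts[OF v]
  have "intO L (\<lambda>x. F x * pdiff i v (x - y)) = - intO L (\<lambda>x. G x * v (x - y))" for y
    using w[unfolded weak_d1_def, rule_format, OF test_fun_shift(1)[OF v, of y]]
    unfolding test_fun_shift(2)[OF v] .
  then show "intO L (\<lambda>x. moll L g F x * pdiff i v x) = - intO L (\<lambda>x. moll L g G x * v x)"
    unfolding test_pairing_moll[OF F tf(4,3)] test_pairing_moll[OF G tf(2,1)] by simp
qed

lemma weak_d2_moll:
  assumes F: "F \<in> borel_measurable borel" "per L F" "integrable (MO L) F"
    and G: "G \<in> borel_measurable borel" "per L G" "integrable (MO L) G"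
    and w: "weak_d2 L F i j G"
  shows "weak_d2 L (moll L g F) i j (moll L g G)"
  unfolding weak_d2_def
proof (intro allI impI)
  fix v assume v: "test_fun L v"
  note tf = test_fun_facts[OF v]
  have "intO L (\<lambda>x. F x * pdiff j (pdiff i v) (x - y)) = intO L (\<lambda>x. G x * v (x - y))" for y
    using w[unfolded weak_d2_def, rule_format, OF test_fun_shift(1)[OF v, of y]]
    unfolding test_fun_shift(3)[OF v] .
  then show "intO L (\<lambda>x. moll L g F x * pdiff j (pdiff i v) x) = intO L (\<lambda>x. moll L g G x * v x)"
    unfolding test_pairing_moll[OF F tf(6,5)] test_pairing_moll[OF G tf(2,1)] by simp
qed

end

lemma intO_cong_AE:
  assumes "f \<in> borel_measurable (LM L)" "F \<in> borel_measurable (LM L)" "AE x in LM L. f x = F x"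
  shows "intO L f = intO L F"
  unfolding intO_def by (rule integral_cong_AE) (use assms in auto)

lemma L2on_cong_AE:
  assumes f: "L2on L f" and F: "F \<in> borel_measurable (LM L)" and eq: "AE x in LM L. f x = F x"
  shows "L2on L F"
proof -
  have "integrable (LM L) (\<lambda>x. (f x)\<^sup>2) \<longleftrightarrow> integrable (LM L) (\<lambda>x. (F x)\<^sup>2)"
    by (rule integrable_cong_AE) (use L2onD(1)[OF f] F eq in auto)
  with L2onD(2)[OF f] F show ?thesis by (simp add: L2on_def)
qed

lemma L2on_periodic_rep:
  fixes L :: "real^'d"
  assumes Lpos: "\<forall>i. 0 < L $ i" and f: "L2on L f"
  obtains F where "F \<in> borel_measurable borel" "per L F" "AE x in LM L. f x = F x" "L2on L F" "integrable (MO L) F"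
proof -
  obtain F where F: "F \<in> borel_measurable borel" "per L F" "AE x in LM L. f x = F x"
    using periodic_rep[OF Lpos L2onD(1)[OF f]] by metis
  moreover have "L2on L F" by (rule L2on_cong_AE[OF f measurable_LM[OF F(1)] F(3)])
  moreover have "integrable (MO L) F"
    unfolding MO_LM(2)[OF F(1)] by (rule L2on_integrable) fact
  ultimately show ?thesis using that by blast
qed

lemma intO_mult_cong_AE:
  assumes "L2on L f" "L2on L F" "L2on L p" "AE x in LM L. f x = F x"
  shows "intO L (\<lambda>x. f x * p x) = intO L (\<lambda>x. F x * p x)"
proof (rule intO_cong_AE)
  show "AE x in LM L. f x * p x = F x * p x" using assms(4) by eventually_elim simp
qed (intro borel_measurable_times L2onD assms)+

lemma weak_d1_cong:
  assumes "L2on L f" "L2on L F" "AE x in LM L. f x = F x" "L2on L g" "L2on L G" "AE x in LM L. g x = G x"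
    and "weak_d1 L f i g"
  shows "weak_d1 L F i G"
  using assms(7) unfolding weak_d1_def
  by (metis intO_mult_cong_AE[OF assms(1,2) _ assms(3)] intO_mult_cong_AE[OF assms(4,5) _ assms(6)] test_fun_L2on(1,2))

lemma weak_d2_cong:
  assumes "L2on L f" "L2on L F" "AE x in LM L. f x = F x" "L2on L g" "L2on L G" "AE x in LM L. g x = G x"
    and "weak_d2 L f i j g"
  shows "weak_d2 L F i j G"
  using assms(7) unfolding weak_d2_def
  by (metis intO_mult_cong_AE[OF assms(1,2) _ assms(3)] intO_mult_cong_AE[OF assms(4,5) _ assms(6)] test_fun_L2on(1,3))

context mollifier begin

lemma moll_H2per:
  assumes f: "f \<in> H2per L" and F: "F \<in> borel_measurable borel" "per L F" "integrable (MO L) F"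
    and F2: "L2on L F" and fF: "AE x in LM L. f x = F x"
  shows "moll L g F \<in> H2per L"
    "intO L (\<lambda>x. (moll L g F x)\<^sup>2) \<le> intO L (\<lambda>x. (f x)\<^sup>2)"
    "intO L (\<lambda>x. (lap L (moll L g F) x + moll L g F x)\<^sup>2) \<le> intO L (\<lambda>x. (lap L f x + f x)\<^sup>2)"
proof -
  note f2 = H2perD(2)[OF f]
  have 1: "\<exists>G. L2on L G \<and> weak_d1 L (moll L g F) i G" for i
  proof -
    obtain h where h: "L2on L h" "weak_d1 L f i h" using H2perD(3)[OF f] by blast
    obtain H where H: "H \<in> borel_measurable borel" "per L H" "AE x in LM L. h x = H x" "L2on L H" "integrable (MO L) H"
      using L2on_periodic_rep[OF Lpos h(1)] by metis
    have "weak_d1 L F i H" by (rule weak_d1_cong[OF f2 F2 fF h(1) H(4,3) h(2)])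
    from weak_d1_moll[OF F H(1,2,5) this] moll_L2on[OF H(1,2,5)] show ?thesis by blast
  qed
  have 2: "\<exists>G. L2on L G \<and> weak_d2 L (moll L g F) i j G" for i j
  proof -
    obtain h where h: "L2on L h" "weak_d2 L f i j h" using H2perD(4)[OF f] by blast
    obtain H where H: "H \<in> borel_measurable borel" "per L H" "AE x in LM L. h x = H x" "L2on L H" "integrable (MO L) H"
      using L2on_periodic_rep[OF Lpos h(1)] by metis
    have "weak_d2 L F i j H" by (rule weak_d2_cong[OF f2 F2 fF h(1) H(4,3) h(2)])
    from weak_d2_moll[OF F H(1,2,5) this] moll_L2on[OF H(1,2,5)] show ?thesis by blast
  qed
  show mH: "moll L g F \<in> H2per L"
    using 1 2 per_moll[OF F(2)] moll_L2on[OF F] by (simp add: H2per_def)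
  have contr: "intO L (\<lambda>x. (moll L g H x)\<^sup>2) \<le> intO L (\<lambda>x. (h x)\<^sup>2)"
    if H: "H \<in> borel_measurable borel" "per L H" "integrable (MO L) H" "L2on L H"
      and h: "h \<in> borel_measurable (LM L)" "AE x in LM L. h x = H x" for H h
  proof -
    note [measurable] = H(1)
    have m: "(\<lambda>x. (H x)\<^sup>2) \<in> borel_measurable borel" "(\<lambda>x. (moll L g H x)\<^sup>2) \<in> borel_measurable borel"
      by measurable
    have "(\<integral>x. (moll L g H x)\<^sup>2 \<partial>MO L) \<le> (\<integral>x. (H x)\<^sup>2 \<partial>MO L)"
      using L2onD(2)[OF H(4)] by (intro moll_L2_contraction H) (simp add: MO_LM(2)[OF m(1)])
    then have "intO L (\<lambda>x. (moll L g H x)\<^sup>2) \<le> intO L (\<lambda>x. (H x)\<^sup>2)"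
      by (simp only: MO_LM(1)[OF m(1)] MO_LM(1)[OF m(2)])
    also have "intO L (\<lambda>x. (H x)\<^sup>2) = intO L (\<lambda>x. (h x)\<^sup>2)"
    proof (rule intO_cong_AE)
      show "AE x in LM L. (H x)\<^sup>2 = (h x)\<^sup>2" using h(2) by eventually_elim simp
    qed (use h(1) measurable_LM[OF m(1)] in auto)
    finally show ?thesis .
  qed
  show "intO L (\<lambda>x. (moll L g F x)\<^sup>2) \<le> intO L (\<lambda>x. (f x)\<^sup>2)"
    by (rule contr[OF F F2 L2onD(1)[OF f2] fF])
  obtain h where h: "\<And>i. L2on L (h i)" "\<And>i. weak_d2 L f i i (h i)" "lap L f = (\<lambda>x. \<Sum>i\<in>UNIV. h i x)"
    using lap_weak[OF f] by metis
  have "\<forall>i. \<exists>H. H \<in> borel_measurable borel \<and> per L H \<and> (AE x in LM L. h i x = H x) \<and> L2on L H \<and> integrable (MO L) H"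
    using L2on_periodic_rep[OF Lpos h(1)] by metis
  then obtain H where H: "\<And>i. H i \<in> borel_measurable borel" "\<And>i. per L (H i)" "\<And>i. AE x in LM L. h i x = H i x"
     "\<And>i. L2on L (H i)" "\<And>i. integrable (MO L) (H i)"
    by metis
  have w: "weak_d2 L (moll L g F) i i (moll L g (H i))" for i
    by (rule weak_d2_moll[OF F H(1,2,5) weak_d2_cong[OF f2 F2 fF h(1) H(4,3) h(2)]])
  define S where "S x = (\<Sum>i\<in>UNIV. H i x)" for x
  have S: "S \<in> borel_measurable borel" "per L S" "integrable (MO L) S" "L2on L S"
    using H by (auto simp: S_def[abs_def] per_def intro!: borel_measurable_sum L2on_sum)
  have mS: "moll L g S x = (\<Sum>i\<in>UNIV. moll L g (H i) x)" for x
    unfolding S_def[abs_def] by (rule moll_sum) (auto simp: H)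
  have "AE x in LM L. \<forall>i\<in>UNIV. h i x = H i x"
    by (rule AE_finite_allI[OF finite H(3)])
  then have lS: "AE x in LM L. lap L f x + f x = S x + F x"
    using fF by eventually_elim (simp add: h(3) S_def)
  define T where "T x = S x + F x" for x
  have T: "T \<in> borel_measurable borel" "per L T" "integrable (MO L) T" "L2on L T"
    using S F F2 by (auto simp: T_def[abs_def] per_def intro!: borel_measurable_add L2on_add)
  have "AE x in LM L. lap L (moll L g F) x = (\<Sum>i\<in>UNIV. moll L g (H i) x)"
    by (rule lap_eqI[OF Lpos moll_L2on[OF H(1,2,5)] w])
  then have "AE x in LM L. (lap L (moll L g F) x + moll L g F x)\<^sup>2 = (moll L g T x)\<^sup>2"
    unfolding T_def[abs_def] by eventually_elim (simp add: moll_add[OF S(1,2,3) F] mS)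
  then have "intO L (\<lambda>x. (lap L (moll L g F) x + moll L g F x)\<^sup>2) = intO L (\<lambda>x. (moll L g T x)\<^sup>2)"
    using L2onD(1)[OF L2on_lap[OF mH]] L2onD(1)[OF moll_L2on[OF F]] L2onD(1)[OF moll_L2on[OF T(1,2,3)]]
    by (intro intO_cong_AE) auto
  also have "\<dots> \<le> intO L (\<lambda>x. (lap L f x + f x)\<^sup>2)"
    using lS L2onD(1)[OF L2on_lap[OF f]] L2onD(1)[OF f2]
    by (intro contr[OF T]) (auto simp: T_def)
  finally show "intO L (\<lambda>x. (lap L (moll L g F) x + moll L g F x)\<^sup>2) \<le> intO L (\<lambda>x. (lap L f x + f x)\<^sup>2)" .
qed

end

lemma cube_mollifier:
  fixes L :: "real^'d"
  assumes Lpos: "\<forall>i. 0 < L $ i" and h: "0 < h" "\<And>i. h \<le> L $ i"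
  defines "g \<equiv> \<lambda>y. indicator (cbox 0 (h *\<^sub>R One)) y / h ^ CARD('d)"
  shows "mollifier L g (1 / h ^ CARD('d))"
    "\<And>F. F \<in> borel_measurable borel \<Longrightarrow> moll L g F x = (LINT y:cbox x (x + h *\<^sub>R One)|lebesgue. F y) / h ^ CARD('d)"
proof -
  have sub: "cbox 0 (h *\<^sub>R One) \<subseteq> Omega L"
    using h(1) by (auto simp: mem_Omega mem_box_cart) (meson h(2) order_trans)
  have MO: "MO L = density lborel (\<lambda>x. ennreal (indicator (Omega L) x))"
    unfolding MO_def by (rule density_cong) (auto simp: indicator_def)
  have ind: "indicator (Omega L) y * (indicator (cbox 0 (h *\<^sub>R One)) y * c) = indicator (cbox 0 (h *\<^sub>R One)) y * (c::real)" for y c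
    using sub by (auto simp: indicator_def)
  have [measurable]: "g \<in> borel_measurable borel" unfolding g_def by measurable
  have conv: "integral\<^sup>L (MO L) (\<lambda>y. G y * g y) = (\<integral>y. indicator (cbox 0 (h *\<^sub>R One)) y * G y \<partial>lborel) / h ^ CARD('d)"
    if [measurable]: "G \<in> borel_measurable borel" for G
  proof -
    have "integral\<^sup>L (MO L) (\<lambda>y. G y * g y) = (\<integral>y. indicator (Omega L) y *\<^sub>R (G y * g y) \<partial>lborel)"
      unfolding MO by (rule integral_density) auto
    also have "(\<lambda>y. indicator (Omega L) y *\<^sub>R (G y * g y)) = (\<lambda>y. indicator (cbox 0 (h *\<^sub>R One)) y * G y / h ^ CARD('d))"
      using sub by (auto simp: g_def indicator_def fun_eq_iff)
    finally show ?thesis by simp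
  qed
  have "measure lborel (cbox 0 (h *\<^sub>R One) :: (real^'d) set) = h ^ CARD('d)"
    using content_cbox_cart[of 0 "h *\<^sub>R One :: real^'d"] h(1) by (simp add: interval_ne_empty_cart)
  then have "integral\<^sup>L (MO L) g = 1"
    using conv[of "\<lambda>_. 1"] h(1) by simp
  then show "mollifier L g (1 / h ^ CARD('d))"
    using Lpos h(1) by unfold_locales (auto simp: g_def indicator_def)
  fix F :: "real^'d \<Rightarrow> real" assume [measurable]: "F \<in> borel_measurable borel"
  have "(\<integral>y. indicator (cbox 0 (h *\<^sub>R One)) y * F (x + y) \<partial>lborel)
      = (\<integral>y. indicator (cbox x (x + h *\<^sub>R One)) (x + y) * F (x + y) \<partial>lborel)"
    by (intro Bochner_Integration.integral_cong) (auto simp: indicator_def mem_box_cart)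
  also have "\<dots> = (\<integral>y. indicator (cbox x (x + h *\<^sub>R One)) y * F y \<partial>distr lborel borel ((+) x))"
    by (rule integral_distr[symmetric]) auto
  also have "\<dots> = (\<integral>y. indicator (cbox x (x + h *\<^sub>R One)) y * F y \<partial>lborel)"
    by (simp add: lborel_distr_plus)
  also have "\<dots> = (LINT y:cbox x (x + h *\<^sub>R One)|lebesgue. F y)"
    unfolding set_lebesgue_integral_def by (subst integral_completion) auto
  finally show "moll L g F x = (LINT y:cbox x (x + h *\<^sub>R One)|lebesgue. F y) / h ^ CARD('d)"
    unfolding moll_def by (subst conv) auto
qed

lemma H2per_bound_from_bounded:
  fixes L :: "real^'d"
  assumes Lpos: "\<forall>i. 0 < L $ i" and f: "f \<in> H2per L"
    and bd: "\<And>\<psi> B. \<psi> \<in> H2per L \<Longrightarrow> AE x in LM L. \<bar>\<psi> x\<bar> \<le> B \<Longrightarrow>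
        intO L (\<lambda>x. (\<psi> x)\<^sup>2) \<le> intO L (\<lambda>x. (f x)\<^sup>2) \<Longrightarrow>
        intO L (\<lambda>x. (lap L \<psi> x + \<psi> x)\<^sup>2) \<le> intO L (\<lambda>x. (lap L f x + f x)\<^sup>2) \<Longrightarrow>
        AE x in LM L. \<bar>\<psi> x\<bar> \<le> M"
  shows "AE x in LM L. \<bar>f x\<bar> \<le> M"
proof -
  obtain F where F: "F \<in> borel_measurable borel" "per L F" "AE x in LM L. f x = F x" "L2on L F" "integrable (MO L) F"
    using L2on_periodic_rep[OF Lpos H2perD(2)[OF f]] by metis
  define h0 where "h0 = Min (range (\<lambda>i. L $ i))"
  have h0: "0 < h0" unfolding h0_def using Lpos by (subst Min_gr_iff) auto
  have h0_le: "h0 \<le> L $ i" for i unfolding h0_def by (rule Min_le) auto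
  define h where "h n = h0 / real (Suc n)" for n
  have hp: "0 < h n" for n using h0 by (simp add: h_def)
  have hL: "h n \<le> L $ i" for n i
  proof -
    have "h n \<le> h0" using h0 by (simp add: h_def field_simps)
    then show ?thesis using h0_le[of i] by linarith
  qed
  define g where "g n = (\<lambda>y::real^'d. indicator (cbox 0 (h n *\<^sub>R One)) y / h n ^ CARD('d))" for n
  have "AE x in LM L. \<bar>moll L (g n) F x\<bar> \<le> M" for n
  proof -
    interpret m: mollifier L "g n" "1 / h n ^ CARD('d)"
      unfolding g_def by (rule cube_mollifier(1)[OF Lpos hp hL])
    show ?thesis
      using m.moll_bound(2)[OF F(1,2,5)]
      by (intro bd[OF m.moll_H2per(1)[OF f F(1,2,5,4,3)] _ m.moll_H2per(2,3)[OF f F(1,2,5,4,3)]] AE_I2)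
  qed
  then have "AE x in LM L. \<forall>n. \<bar>moll L (g n) F x\<bar> \<le> M"
    by (simp add: AE_all_countable)
  with F(3) lebesgue_points[OF L2on_integrable[OF F(4)]] show ?thesis
  proof eventually_elim
    case (elim x)
    have "\<bar>F x\<bar> \<le> M + e" if e: "e > 0" for e
    proof -
      obtain d where d: "d > 0" "\<And>h. 0 < h \<Longrightarrow> h < d \<Longrightarrow>
         \<bar>(LINT y:cbox x (x + h *\<^sub>R One)|lebesgue. F y) / h ^ CARD('d) - F x\<bar> < e"
        using elim(2) e by meson
      obtain n where "inverse (real (Suc n)) < d / h0"
        using reals_Archimedean[of "d / h0"] d(1) h0 by auto
      then have "h n < d" using h0 by (simp add: h_def field_simps)
      from d(2)[OF hp this] have "\<bar>moll L (g n) F x - F x\<bar> < e"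
        unfolding g_def cube_mollifier(2)[OF Lpos hp hL F(1)] .
      moreover have "\<bar>moll L (g n) F x\<bar> \<le> M" using elim(3) by blast
      ultimately show ?thesis by linarith
    qed
    then show ?case using elim(1) field_le_epsilon by metis
  qed
qed

subsection \<open>The supremum bound\<close>

lemma integrable_power_bounded:
  assumes "f \<in> borel_measurable (LM L)" "AE x in LM L. \<bar>f x\<bar> \<le> B"
  shows "integrable (LM L) (\<lambda>x. (f x :: real) ^ k)"
proof (rule finite_measure.integrable_const_bound[OF finite_measure_LM, where B="B ^ k"])
  show "AE x in LM L. norm (f x ^ k) \<le> B ^ k"
    using assms(2) by eventually_elim (auto simp: power_abs intro: power_mono)
qed (use assms(1) in measurable)

lemma intO_mono_AE:
  assumes "integrable (LM L) f" "integrable (LM L) g" "AE x in LM L. f x \<le> g x"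
  shows "intO L f \<le> intO L g"
  unfolding intO_def using assms by (intro integral_mono_AE)

lemma intO_const [simp]: "intO L (\<lambda>x. c) = c * vol L"
  by (simp add: intO_def vol_def measure_restrict_space Omega_lmeasurable)

lemma energy_bounded:
  assumes f: "f \<in> H2per L" and B: "AE x in LM L. \<bar>f x\<bar> \<le> B"
  shows "finite_energy L \<alpha> \<gamma> f"
    "energy L \<alpha> \<gamma> f = 1/2 * intO L (\<lambda>x. (lap L f x + f x)\<^sup>2) - \<alpha>/2 * intO L (\<lambda>x. (f x)\<^sup>2)
       + intO L (\<lambda>x. (f x)^4 / 24 - \<gamma>/6 * (f x)^3)"
proof -
  note m = L2onD(1)[OF H2perD(2)[OF f]]
  have "integrable (LM L) (\<lambda>x. (lap L f x + f x)\<^sup>2)"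
    by (rule L2onD(2)[OF L2on_add[OF L2on_lap[OF f] H2perD(2)[OF f]]])
  note i = this L2onD(2)[OF H2perD(2)[OF f]] integrable_power_bounded[OF m B, of 4] integrable_power_bounded[OF m B, of 3]
  show "finite_energy L \<alpha> \<gamma> f"
    unfolding finite_energy_def edens_def[abs_def] using i by simp
  show "energy L \<alpha> \<gamma> f = 1/2 * intO L (\<lambda>x. (lap L f x + f x)\<^sup>2) - \<alpha>/2 * intO L (\<lambda>x. (f x)\<^sup>2)
       + intO L (\<lambda>x. (f x)^4 / 24 - \<gamma>/6 * (f x)^3)"
    unfolding energy_def edens_def[abs_def] intO_def using i by simp
qed

lemma supabs_le_imp_AE:
  assumes "supabs L f \<le> ereal r" shows "AE x in LM L. \<bar>f x\<bar> \<le> r"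
  using esssup_AE[of "\<lambda>x. ereal \<bar>f x\<bar>" "LM L"]
proof eventually_elim
  case (elim x)
  then have "ereal \<bar>f x\<bar> \<le> ereal r" using assms unfolding supabs_def by (rule order_trans)
  then show ?case by simp
qed

lemma abs_le_sqrtD: "\<bar>z\<bar> \<le> sqrt X \<Longrightarrow> z\<^sup>2 \<le> X"
proof -
  assume *: "\<bar>z\<bar> \<le> sqrt X"
  then have "0 \<le> sqrt X" by linarith
  then have "0 \<le> X" by simp
  moreover have "\<bar>z\<bar>\<^sup>2 \<le> (sqrt X)\<^sup>2" using * by (intro power_mono) auto
  ultimately show ?thesis by simp
qed

text \<open>The square of the factor with which the assumed inequality is scaled: it makes the quartic term at most
  a quarter of the left-hand side.\<close>

definition scale2 :: "real \<Rightarrow> real \<Rightarrow> real" where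
  "scale2 lam a = min 1 (6 * lam / (a + 1))"

definition sup_bound :: "real \<Rightarrow> real \<Rightarrow> real \<Rightarrow> real \<Rightarrow> real \<Rightarrow> real \<Rightarrow> real" where
  "sup_bound \<alpha> \<gamma> lam c a b =
     sqrt (2 * ((b / 2 + \<bar>\<alpha>\<bar> * a / 2 + (\<gamma> * a / 6)\<^sup>2 / lam + c) / (lam * scale2 lam a)))"

lemma scale2_bounds:
  assumes "lam > 0" "0 \<le> a"
  shows "0 < scale2 lam a" "scale2 lam a \<le> 1" "scale2 lam a * a \<le> 6 * lam"
proof -
  show "0 < scale2 lam a" "scale2 lam a \<le> 1" using assms by (auto simp: scale2_def)
  have "scale2 lam a * a \<le> 6 * lam / (a + 1) * a"
    using assms by (intro mult_right_mono) (auto simp: scale2_def)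
  also have "\<dots> \<le> 6 * lam" using assms by (simp add: field_simps)
  finally show "scale2 lam a * a \<le> 6 * lam" .
qed

lemma absorption_ineq:
  fixes T Q a b lam \<gamma> \<alpha> :: real
  assumes T: "0 < T" "T \<le> 1" "T * a \<le> 6 * lam" and pos: "0 < lam" "0 \<le> a" "0 \<le> b" "0 \<le> Q" "0 \<le> \<gamma>"
  shows "1/2 * (T * b) + \<bar>\<alpha>\<bar>/2 * (T * a) + (T\<^sup>2 * Q / 24 + \<gamma>/6 * (T * sqrt T) * sqrt Q) * a
     \<le> b / 2 + \<bar>\<alpha>\<bar> * a / 2 + (\<gamma> * a / 6)\<^sup>2 / lam + T * Q * lam / 2"
proof -
  have 1: "T * b \<le> b" "T * a \<le> a" using T pos by (auto intro: mult_left_le_one_le)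
  have 2: "T\<^sup>2 * Q / 24 * a \<le> T * Q * lam / 4"
  proof -
    have "(T * a) * (T * Q) \<le> (6 * lam) * (T * Q)" using T pos by (intro mult_right_mono) auto
    then show ?thesis by (simp add: power2_eq_square algebra_simps)
  qed
  define s where "s = sqrt T * sqrt Q"
  have s2: "s\<^sup>2 = T * Q" using T pos by (simp add: s_def power_mult_distrib)
  have "0 \<le> (lam * s / 2 - \<gamma> * a / 6)\<^sup>2" by simp
  then have "lam * (s * (\<gamma> * a / 6)) \<le> lam * (lam * s\<^sup>2 / 4) + (\<gamma> * a / 6)\<^sup>2"
    by (simp add: power2_eq_square algebra_simps)
  then have "lam * (s * (\<gamma> * a / 6)) \<le> lam * (lam * s\<^sup>2 / 4 + (\<gamma> * a / 6)\<^sup>2 / lam)"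
    using pos by (simp add: distrib_left)
  then have 3: "s * (\<gamma> * a / 6) \<le> lam * (T * Q) / 4 + (\<gamma> * a / 6)\<^sup>2 / lam"
    unfolding s2[symmetric] using pos by (simp only: mult_le_cancel_left_pos)
  have "\<gamma>/6 * (T * sqrt T) * sqrt Q * a = T * (s * (\<gamma> * a / 6))"
    by (simp add: s_def)
  also have "\<dots> \<le> 1 * (s * (\<gamma> * a / 6))"
    using T pos by (intro mult_right_mono) (auto simp: s_def)
  finally have 4: "\<gamma>/6 * (T * sqrt T) * sqrt Q * a \<le> lam * (T * Q) / 4 + (\<gamma> * a / 6)\<^sup>2 / lam"
    using 3 by simp
  have "\<bar>\<alpha>\<bar>/2 * (T * a) \<le> \<bar>\<alpha>\<bar> / 2 * a" using 1 by (intro mult_left_mono) auto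
  then have "1/2 * (T * b) + \<bar>\<alpha>\<bar>/2 * (T * a) + (T\<^sup>2 * Q / 24 * a + \<gamma>/6 * (T * sqrt T) * sqrt Q * a)
    \<le> b / 2 + \<bar>\<alpha>\<bar> / 2 * a + (T * Q * lam / 4 + (lam * (T * Q) / 4 + (\<gamma> * a / 6)\<^sup>2 / lam))"
    using 1 2 4 by (intro add_mono) auto
  then show ?thesis by (simp add: algebra_simps)
qed

lemma sup_bound_of_bounded:
  fixes L :: "real^'d"
  assumes Lpos: "\<forall>i. 0 < L $ i" and gam: "\<gamma> \<ge> 0" and lam: "lam > 0" and c: "0 \<le> c"
    and lam_bound: "\<forall>\<psi>\<in>H2per L. finite_energy L \<alpha> \<gamma> \<psi> \<longrightarrow>
        supabs L \<psi> \<le> ereal (sqrt ((energy L \<alpha> \<gamma> \<psi> + c) / lam))"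
    and \<psi>: "\<psi> \<in> H2per L" and B: "AE x in LM L. \<bar>\<psi> x\<bar> \<le> B"
    and a: "intO L (\<lambda>x. (\<psi> x)\<^sup>2) \<le> a" and b: "intO L (\<lambda>x. (lap L \<psi> x + \<psi> x)\<^sup>2) \<le> b"
  shows "AE x in LM L. \<bar>\<psi> x\<bar> \<le> sup_bound \<alpha> \<gamma> lam c a b"
proof -
  define T where "T = scale2 lam a"
  define t where "t = sqrt T"
  define K where "K = (b / 2 + \<bar>\<alpha>\<bar> * a / 2 + (\<gamma> * a / 6)\<^sup>2 / lam + c) / (lam * T)"
  have I0: "0 \<le> intO L (\<lambda>x. (\<psi> x)\<^sup>2)" "0 \<le> intO L (\<lambda>x. (lap L \<psi> x + \<psi> x)\<^sup>2)"
    by (simp_all add: intO_def)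
  then have ab: "0 \<le> a" "0 \<le> b" using a b by auto
  have T: "0 < T" "T \<le> 1" "T * a \<le> 6 * lam" using scale2_bounds[OF lam ab(1)] by (simp_all add: T_def)
  have t: "0 < t" "t\<^sup>2 = T" using T by (simp_all add: t_def)
  have t34: "t ^ 3 = T * sqrt T" "t ^ 4 = T\<^sup>2"
  proof -
    have "t ^ 3 = t\<^sup>2 * t" "t ^ 4 = (t\<^sup>2)\<^sup>2" by (simp_all add: power2_eq_square power3_eq_cube power4_eq_xxxx)
    then show "t ^ 3 = T * sqrt T" "t ^ 4 = T\<^sup>2" by (simp_all add: t(2) t_def[symmetric])
  qed
  have K: "0 \<le> K" unfolding K_def using ab lam c T by (intro divide_nonneg_pos add_nonneg_nonneg) auto
  have step: "AE x in LM L. (\<psi> x)\<^sup>2 \<le> Q / 2 + K" if Q: "AE x in LM L. (\<psi> x)\<^sup>2 \<le> Q" "0 \<le> Q" for Q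
  proof -
    have mem: "(\<lambda>x. t * \<psi> x) \<in> H2per L" by (rule H2per_cmult[OF \<psi>])
    have bdd: "AE x in LM L. \<bar>t * \<psi> x\<bar> \<le> t * B"
      using B by eventually_elim (use t in \<open>simp add: abs_mult\<close>)
    have m: "\<psi> \<in> borel_measurable (LM L)" by (rule L2onD(1)[OF H2perD(2)[OF \<psi>]])
    have ml: "lap L \<psi> \<in> borel_measurable (LM L)" by (rule L2onD(1)[OF L2on_lap[OF \<psi>]])
    have mlt: "lap L (\<lambda>x. t * \<psi> x) \<in> borel_measurable (LM L)" by (rule L2onD(1)[OF L2on_lap[OF mem]])
    have e1: "intO L (\<lambda>x. (lap L (\<lambda>x. t * \<psi> x) x + t * \<psi> x)\<^sup>2) = T * intO L (\<lambda>x. (lap L \<psi> x + \<psi> x)\<^sup>2)"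
    proof -
      have "intO L (\<lambda>x. (lap L (\<lambda>x. t * \<psi> x) x + t * \<psi> x)\<^sup>2) = intO L (\<lambda>x. T * (lap L \<psi> x + \<psi> x)\<^sup>2)"
      proof (rule intO_cong_AE)
        show "AE x in LM L. (lap L (\<lambda>x. t * \<psi> x) x + t * \<psi> x)\<^sup>2 = T * (lap L \<psi> x + \<psi> x)\<^sup>2"
          using lap_cmult[OF Lpos \<psi>, of t]
          by eventually_elim (simp add: t(2)[symmetric] power_mult_distrib[symmetric] distrib_left)
      qed (use m ml mlt in auto)
      then show ?thesis by (simp add: intO_def)
    qed
    have e2: "intO L (\<lambda>x. (t * \<psi> x)\<^sup>2) = T * intO L (\<lambda>x. (\<psi> x)\<^sup>2)"
      by (simp add: power_mult_distrib t(2) intO_def)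
    have e3: "intO L (\<lambda>x. (t * \<psi> x)^4 / 24 - \<gamma>/6 * (t * \<psi> x)^3)
        \<le> intO L (\<lambda>x. (T\<^sup>2 * Q / 24 + \<gamma>/6 * (T * sqrt T) * sqrt Q) * (\<psi> x)\<^sup>2)"
    proof (rule intO_mono_AE)
      have mt: "(\<lambda>x. t * \<psi> x) \<in> borel_measurable (LM L)" using m by simp
      show "integrable (LM L) (\<lambda>x. (t * \<psi> x)^4 / 24 - \<gamma>/6 * (t * \<psi> x)^3)"
        using integrable_power_bounded[OF mt bdd, of 4] integrable_power_bounded[OF mt bdd, of 3]
        by (intro Bochner_Integration.integrable_diff integrable_mult_right integrable_divide) auto
      show "integrable (LM L) (\<lambda>x. (T\<^sup>2 * Q / 24 + \<gamma>/6 * (T * sqrt T) * sqrt Q) * (\<psi> x)\<^sup>2)"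
        by (intro integrable_mult_right L2onD(2)[OF H2perD(2)[OF \<psi>]])
      show "AE x in LM L. (t * \<psi> x)^4 / 24 - \<gamma>/6 * (t * \<psi> x)^3
          \<le> (T\<^sup>2 * Q / 24 + \<gamma>/6 * (T * sqrt T) * sqrt Q) * (\<psi> x)\<^sup>2"
        using Q(1)
      proof eventually_elim
        case (elim x)
        define z where "z = \<psi> x"
        have z: "z\<^sup>2 \<le> Q" using elim by (simp add: z_def)
        then have az: "\<bar>z\<bar> \<le> sqrt Q" using real_sqrt_le_mono[of "z\<^sup>2" Q] by simp
        have z4: "z ^ 4 \<le> Q * z\<^sup>2"
          using mult_right_mono[OF z, of "z\<^sup>2"] by (simp add: power2_eq_square power4_eq_xxxx mult.assoc)
        have "- (z ^ 3) = - z * z\<^sup>2" by (simp add: power2_eq_square power3_eq_cube)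
        also have "\<dots> \<le> sqrt Q * z\<^sup>2" using az by (intro mult_right_mono) auto
        finally have z3: "- (z ^ 3) \<le> sqrt Q * z\<^sup>2" .
        have "T\<^sup>2 / 24 * z ^ 4 \<le> T\<^sup>2 / 24 * (Q * z\<^sup>2)" using z4 by (intro mult_left_mono) auto
        moreover have "\<gamma>/6 * (T * sqrt T) * (- (z ^ 3)) \<le> \<gamma>/6 * (T * sqrt T) * (sqrt Q * z\<^sup>2)"
          using z3 gam T by (intro mult_left_mono) auto
        ultimately show ?case
          unfolding z_def[symmetric] power_mult_distrib t34 by (simp add: algebra_simps)
      qed
    qed
    have "energy L \<alpha> \<gamma> (\<lambda>x. t * \<psi> x) \<le> 1/2 * (T * b) + \<bar>\<alpha>\<bar>/2 * (T * a) + (T\<^sup>2 * Q / 24 + \<gamma>/6 * (T * sqrt T) * sqrt Q) * a"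
    proof -
      have "- (\<alpha>/2 * (T * intO L (\<lambda>x. (\<psi> x)\<^sup>2))) \<le> \<bar>\<alpha>\<bar>/2 * (T * intO L (\<lambda>x. (\<psi> x)\<^sup>2))"
        using mult_right_mono[of "- (\<alpha>/2)" "\<bar>\<alpha>\<bar>/2" "T * intO L (\<lambda>x. (\<psi> x)\<^sup>2)"] I0 T by simp
      also have "\<dots> \<le> \<bar>\<alpha>\<bar>/2 * (T * a)" using a T by (intro mult_left_mono) auto
      finally have i1: "- (\<alpha>/2 * (T * intO L (\<lambda>x. (\<psi> x)\<^sup>2))) \<le> \<bar>\<alpha>\<bar>/2 * (T * a)" .
      have i2: "1/2 * (T * intO L (\<lambda>x. (lap L \<psi> x + \<psi> x)\<^sup>2)) \<le> 1/2 * (T * b)"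
        using b T by (intro mult_left_mono) auto
      have "intO L (\<lambda>x. (T\<^sup>2 * Q / 24 + \<gamma>/6 * (T * sqrt T) * sqrt Q) * (\<psi> x)\<^sup>2)
         = (T\<^sup>2 * Q / 24 + \<gamma>/6 * (T * sqrt T) * sqrt Q) * intO L (\<lambda>x. (\<psi> x)\<^sup>2)"
        by (simp add: intO_def)
      also have "\<dots> \<le> (T\<^sup>2 * Q / 24 + \<gamma>/6 * (T * sqrt T) * sqrt Q) * a"
        using a gam T Q by (intro mult_left_mono add_nonneg_nonneg) auto
      finally show ?thesis
        using e3 i1 i2 unfolding energy_bounded(2)[OF mem bdd] e1 e2 by linarith
    qed
    also have "\<dots> \<le> b / 2 + \<bar>\<alpha>\<bar> * a / 2 + (\<gamma> * a / 6)\<^sup>2 / lam + T * Q * lam / 2"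
      by (rule absorption_ineq[OF T lam ab Q(2) gam])
    also have "b / 2 + \<bar>\<alpha>\<bar> * a / 2 + (\<gamma> * a / 6)\<^sup>2 / lam = lam * T * K - c"
      using lam T by (simp add: K_def)
    finally have E: "energy L \<alpha> \<gamma> (\<lambda>x. t * \<psi> x) + c \<le> lam * T * (Q / 2 + K)"
      by (simp add: algebra_simps)
    have "AE x in LM L. \<bar>t * \<psi> x\<bar> \<le> sqrt ((energy L \<alpha> \<gamma> (\<lambda>x. t * \<psi> x) + c) / lam)"
      using lam_bound mem energy_bounded(1)[OF mem bdd] by (intro supabs_le_imp_AE) blast
    then show ?thesis
    proof eventually_elim
      case (elim x)
      have "T * (\<psi> x)\<^sup>2 \<le> (energy L \<alpha> \<gamma> (\<lambda>x. t * \<psi> x) + c) / lam"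
        using abs_le_sqrtD[OF elim] by (simp add: power_mult_distrib t(2))
      also have "\<dots> \<le> (lam * T * (Q / 2 + K)) / lam" using E lam by (intro divide_right_mono) auto
      also have "\<dots> = T * (Q / 2 + K)" using lam by simp
      finally show ?case using T by simp
    qed
  qed
  have "AE x in LM L. (\<psi> x)\<^sup>2 \<le> B\<^sup>2 * (1/2) ^ n + 2 * K" for n
  proof (induction n)
    case 0
    show ?case using B
    proof eventually_elim
      case (elim x)
      then have "\<bar>\<psi> x\<bar>\<^sup>2 \<le> B\<^sup>2" by (intro power_mono) auto
      then show ?case using K by simp
    qed
  next
    case (Suc n)
    from step[OF this] K show ?case by (simp add: field_simps)
  qed
  then have "AE x in LM L. \<forall>n. (\<psi> x)\<^sup>2 \<le> B\<^sup>2 * (1/2) ^ n + 2 * K"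
    by (simp add: AE_all_countable)
  then show ?thesis
  proof eventually_elim
    case (elim x)
    have "(\<lambda>n. B\<^sup>2 * (1/2) ^ n + 2 * K) \<longlonglongrightarrow> B\<^sup>2 * 0 + 2 * K"
      by (intro tendsto_intros LIMSEQ_power_zero) simp
    then have "(\<psi> x)\<^sup>2 \<le> 2 * K"
      using elim by (intro LIMSEQ_le_const[where X="\<lambda>n. B\<^sup>2 * (1/2) ^ n + 2 * K"]) auto
    then have "sqrt ((\<psi> x)\<^sup>2) \<le> sqrt (2 * K)" by (rule real_sqrt_le_mono)
    then show ?case by (simp add: sup_bound_def K_def T_def)
  qed
qed

lemma sup_bound_H2per:
  fixes L :: "real^'d"
  assumes Lpos: "\<forall>i. 0 < L $ i" and gam: "\<gamma> \<ge> 0" and lam: "lam > 0" and c: "0 \<le> c"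
    and lam_bound: "\<forall>\<psi>\<in>H2per L. finite_energy L \<alpha> \<gamma> \<psi> \<longrightarrow>
        supabs L \<psi> \<le> ereal (sqrt ((energy L \<alpha> \<gamma> \<psi> + c) / lam))"
    and f: "f \<in> H2per L"
    and a: "intO L (\<lambda>x. (f x)\<^sup>2) \<le> a" and b: "intO L (\<lambda>x. (lap L f x + f x)\<^sup>2) \<le> b"
  shows "AE x in LM L. \<bar>f x\<bar> \<le> sup_bound \<alpha> \<gamma> lam c a b"
proof (rule H2per_bound_from_bounded[OF Lpos f])
  fix \<psi> B assume "\<psi> \<in> H2per L" "AE x in LM L. \<bar>\<psi> x\<bar> \<le> B"
    "intO L (\<lambda>x. (\<psi> x)\<^sup>2) \<le> intO L (\<lambda>x. (f x)\<^sup>2)"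
    "intO L (\<lambda>x. (lap L \<psi> x + \<psi> x)\<^sup>2) \<le> intO L (\<lambda>x. (lap L f x + f x)\<^sup>2)"
  then show "AE x in LM L. \<bar>\<psi> x\<bar> \<le> sup_bound \<alpha> \<gamma> lam c a b"
    using a b by (intro sup_bound_of_bounded[OF Lpos gam lam c lam_bound]) auto
qed

subsection \<open>The convex splitting step\<close>

text \<open>The integrand that remains when the scheme is tested with \<open>u1 - u0\<close> and the time difference is dropped.\<close>

definition step_dens :: "real^'d \<Rightarrow> real \<Rightarrow> real \<Rightarrow> real \<Rightarrow> (real^'d \<Rightarrow> real) \<Rightarrow> (real^'d \<Rightarrow> real) \<Rightarrow> real^'d \<Rightarrow> real" where
  "step_dens L \<alpha> \<gamma> S u0 u1 x =
     (lap L u1 x + u1 x) * ((lap L u1 x + u1 x) - (lap L u0 x + u0 x)) - \<alpha> * u1 x * (u1 x - u0 x)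
     + S * (u1 x - u0 x)\<^sup>2 + ((u0 x)^3 / 6 - \<gamma>/2 * (u0 x)\<^sup>2) * (u1 x - u0 x)"

lemma L2on_power:
  assumes "f \<in> borel_measurable (LM L)" "AE x in LM L. \<bar>f x\<bar> \<le> B"
  shows "L2on L (\<lambda>x. (f x :: real) ^ k)"
proof (rule L2on_bounded)
  show "AE x in LM L. \<bar>f x ^ k\<bar> \<le> B ^ k"
    using assms(2) by eventually_elim (auto simp: power_abs intro: power_mono)
qed (use assms(1) in measurable)

lemma scheme_mean:
  fixes L :: "real^'d"
  assumes Lpos: "\<forall>i. 0 < L $ i" and alph: "\<alpha> < 1" and S: "S > 0" and dt: "dt > 0"
    and u0: "u0 \<in> H2per L" and B: "AE x in LM L. \<bar>u0 x\<bar> \<le> B" and sch: "scheme_step L \<alpha> \<gamma> S dt u0 u1"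
  shows "intO L (\<lambda>x. u1 x - u0 x) = 0"
proof -
  have u1: "u1 \<in> H2per L" using sch by (simp add: scheme_step_def)
  note m0 = L2onD(1)[OF H2perD(2)[OF u0]]
  have i1: "integrable (LM L) u1" "integrable (LM L) u0" "integrable (LM L) (lap L u1)"
    by (intro L2on_integrable H2perD(2) L2on_lap u0 u1)+
  have i2: "integrable (LM L) (\<lambda>x. (u0 x)^3)" "integrable (LM L) (\<lambda>x. (u0 x)\<^sup>2)"
    by (rule integrable_power_bounded[OF m0 B])+
  have "intO L (\<lambda>x. (u1 x - u0 x) / dt * 1) = - (dEc_weak L \<alpha> S u1 (\<lambda>x. 1) - intO L (\<lambda>x. dEe S \<gamma> u0 x * 1))
          + beta L \<alpha> \<gamma> u0 * intO L (\<lambda>x. 1)"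
    by (rule bspec[OF conjunct2[OF sch[unfolded scheme_step_def]] H2per_const[OF Lpos]])
  moreover have "intO L (\<lambda>x. (u1 x - u0 x) / dt * 1) = (intO L u1 - intO L u0) / dt"
    using i1 by (simp add: intO_def)
  moreover have "dEc_weak L \<alpha> S u1 (\<lambda>x. 1) = intO L (\<lambda>x. lap L u1 x + u1 x - \<alpha> * u1 x + S * u1 x)"
    unfolding dEc_weak_def
  proof (rule intO_cong_AE)
    show "AE x in LM L. (lap L u1 x + u1 x) * (lap L (\<lambda>x. 1) x + 1) - \<alpha> * u1 x * 1 + S * u1 x * 1
       = lap L u1 x + u1 x - \<alpha> * u1 x + S * u1 x"
      using lap_const[OF Lpos, of 1] by eventually_elim simp
  qed (use L2onD(1)[OF L2on_lap[OF u1]] L2onD(1)[OF H2perD(2)[OF u1]]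
        L2onD(1)[OF L2on_lap[OF H2per_const[OF Lpos, of 1]]] in measurable)
  moreover have "intO L (\<lambda>x. lap L u1 x + u1 x - \<alpha> * u1 x + S * u1 x) = (1 - \<alpha> + S) * intO L u1"
    using i1 intO_lap[OF u1] by (simp add: intO_def algebra_simps)
  moreover have "intO L (\<lambda>x. dEe S \<gamma> u0 x * 1) = S * intO L u0 - intO L (\<lambda>x. (u0 x)^3) / 6 + \<gamma>/2 * intO L (\<lambda>x. (u0 x)\<^sup>2)"
    using i1 i2 by (simp add: dEe_def intO_def)
  moreover have "beta L \<alpha> \<gamma> u0 * intO L (\<lambda>x. 1)
     = (1 - \<alpha>) * intO L u0 + intO L (\<lambda>x. (u0 x)^3) / 6 - \<gamma>/2 * intO L (\<lambda>x. (u0 x)\<^sup>2)"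
    using vol_pos[OF Lpos] i1 i2 by (simp add: beta_def intO_def fact_numeral)
  ultimately have "(intO L u1 - intO L u0) / dt = - ((1 - \<alpha> + S) * (intO L u1 - intO L u0))"
    by (simp add: algebra_simps)
  then have "(1 / dt + (1 - \<alpha> + S)) * (intO L u1 - intO L u0) = 0"
    by (simp add: algebra_simps diff_divide_distrib)
  moreover have "1 / dt + (1 - \<alpha> + S) > 0" using alph S dt by (intro add_pos_pos) auto
  ultimately have "intO L u1 - intO L u0 = 0" by simp
  then show ?thesis using i1 by (simp add: intO_def)
qed

lemma scheme_identity:
  fixes L :: "real^'d"
  assumes Lpos: "\<forall>i. 0 < L $ i" and alph: "\<alpha> < 1" and S: "S > 0" and dt: "dt > 0"
    and u0: "u0 \<in> H2per L" and B: "AE x in LM L. \<bar>u0 x\<bar> \<le> B" and sch: "scheme_step L \<alpha> \<gamma> S dt u0 u1"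
  shows "integrable (LM L) (step_dens L \<alpha> \<gamma> S u0 u1)" "intO L (step_dens L \<alpha> \<gamma> S u0 u1) \<le> 0"
proof -
  have u1: "u1 \<in> H2per L" using sch by (simp add: scheme_step_def)
  have wH: "(\<lambda>x. u1 x - u0 x) \<in> H2per L" by (rule H2per_diff[OF u1 u0])
  note m0 = L2onD(1)[OF H2perD(2)[OF u0]]
  define p0 where "p0 x = lap L u0 x + u0 x" for x
  define p1 where "p1 x = lap L u1 x + u1 x" for x
  define w where "w x = u1 x - u0 x" for x
  have L2: "L2on L p0" "L2on L p1" "L2on L w" "L2on L u0" "L2on L u1"
    unfolding p0_def[abs_def] p1_def[abs_def] w_def[abs_def] by (intro L2on_add L2on_diff L2on_lap H2perD(2) u0 u1)+
  have L2p: "L2on L (\<lambda>x. (u0 x)^3)" "L2on L (\<lambda>x. (u0 x)\<^sup>2)" by (rule L2on_power[OF m0 B])+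
  define X1 where "X1 x = p1 x * (p1 x - p0 x) - \<alpha> * (u1 x * w x) + S * (u1 x * w x)" for x
  define X2 where "X2 x = S * (u0 x * w x) - 1/6 * ((u0 x)^3 * w x) + \<gamma>/2 * ((u0 x)\<^sup>2 * w x)" for x
  have i1: "integrable (LM L) X1"
    unfolding X1_def[abs_def]
    by (intro Bochner_Integration.integrable_add Bochner_Integration.integrable_diff integrable_mult_right L2on_integrable_mult L2 L2on_diff)
  have i2: "integrable (LM L) X2"
    unfolding X2_def[abs_def]
    by (intro Bochner_Integration.integrable_add Bochner_Integration.integrable_diff integrable_mult_right L2on_integrable_mult L2 L2p)
  have eq: "step_dens L \<alpha> \<gamma> S u0 u1 = (\<lambda>x. X1 x - X2 x)"
    by (rule ext) (simp add: step_dens_def X1_def X2_def p0_def p1_def w_def power2_eq_square power3_eq_cube field_simps)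
  show "integrable (LM L) (step_dens L \<alpha> \<gamma> S u0 u1)"
    unfolding eq using i1 i2 by simp
  have "intO L (\<lambda>x. (u1 x - u0 x) / dt * (u1 x - u0 x)) = - (dEc_weak L \<alpha> S u1 (\<lambda>x. u1 x - u0 x)
      - intO L (\<lambda>x. dEe S \<gamma> u0 x * (u1 x - u0 x))) + beta L \<alpha> \<gamma> u0 * intO L (\<lambda>x. u1 x - u0 x)"
    by (rule bspec[OF conjunct2[OF sch[unfolded scheme_step_def]] wH])
  moreover have "intO L (\<lambda>x. u1 x - u0 x) = 0" by (rule scheme_mean[OF assms])
  moreover have "dEc_weak L \<alpha> S u1 (\<lambda>x. u1 x - u0 x) = intO L X1"
    unfolding dEc_weak_def
  proof (rule intO_cong_AE)
    show "AE x in LM L. (lap L u1 x + u1 x) * (lap L (\<lambda>x. u1 x - u0 x) x + (u1 x - u0 x)) - \<alpha> * u1 x * (u1 x - u0 x)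
         + S * u1 x * (u1 x - u0 x) = X1 x"
      using lap_diff[OF Lpos u1 u0]
    proof eventually_elim
      case (elim x)
      show ?case unfolding elim X1_def p1_def p0_def w_def by (simp add: algebra_simps)
    qed
  qed (use L2onD(1)[OF L2on_lap[OF u1]] L2onD(1)[OF L2(4)] L2onD(1)[OF L2(5)] L2onD(1)[OF L2on_lap[OF wH]] i1 in measurable)
  moreover have "intO L (\<lambda>x. dEe S \<gamma> u0 x * (u1 x - u0 x)) = intO L X2"
    by (rule arg_cong[where f="intO L"], rule ext) (simp add: dEe_def X2_def w_def field_simps)
  moreover have "intO L (\<lambda>x. (u1 x - u0 x) / dt * (u1 x - u0 x)) \<ge> 0"
    unfolding intO_def using dt by (intro Bochner_Integration.integral_nonneg) (simp add: zero_le_divide_iff)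
  ultimately have "intO L X1 - intO L X2 \<le> 0" by simp
  then show "intO L (step_dens L \<alpha> \<gamma> S u0 u1) \<le> 0"
    unfolding eq using i1 i2 by (simp add: intO_def)
qed

lemma step_dens_lower:
  fixes p0 p1 u0 u1 \<alpha> \<gamma> S C :: real
  assumes u0: "\<bar>u0\<bar> \<le> C" and gam: "0 \<le> \<gamma>"
  shows "p1\<^sup>2 / 2 - p0\<^sup>2 / 2 + (S - \<alpha> - 1/2) * (u1 - u0)\<^sup>2 - (\<bar>\<alpha>\<bar> * C + C^3 / 6 + \<gamma>/2 * C\<^sup>2)\<^sup>2 / 2
     \<le> p1 * (p1 - p0) - \<alpha> * u1 * (u1 - u0) + S * (u1 - u0)\<^sup>2 + (u0^3 / 6 - \<gamma>/2 * u0\<^sup>2) * (u1 - u0)"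
proof -
  define w where "w = u1 - u0"
  define R where "R = \<bar>\<alpha>\<bar> * C + C^3 / 6 + \<gamma>/2 * C\<^sup>2"
  define r where "r = - \<alpha> * u0 + u0^3 / 6 - \<gamma>/2 * u0\<^sup>2"
  have "\<bar>r\<bar> \<le> \<bar>- \<alpha> * u0\<bar> + \<bar>u0^3 / 6\<bar> + \<bar>\<gamma>/2 * u0\<^sup>2\<bar>" unfolding r_def by linarith
  also have "\<dots> = \<bar>\<alpha>\<bar> * \<bar>u0\<bar> + \<bar>u0\<bar>^3 / 6 + \<gamma>/2 * \<bar>u0\<bar>\<^sup>2"
    using gam by (simp add: abs_mult power_abs)
  also have "\<dots> \<le> R" unfolding R_def
    using u0 gam by (intro add_mono mult_left_mono divide_right_mono power_mono) auto
  finally have "\<bar>r\<bar>\<^sup>2 \<le> R\<^sup>2" by (intro power_mono) auto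
  then have rR: "r\<^sup>2 \<le> R\<^sup>2" by simp
  have "0 \<le> (r + w)\<^sup>2" by simp
  then have rw: "- (r * w) \<le> (r\<^sup>2 + w\<^sup>2) / 2" by (simp add: power2_eq_square algebra_simps)
  have e: "p1 * (p1 - p0) - \<alpha> * u1 * (u1 - u0) + S * (u1 - u0)\<^sup>2 + (u0^3 / 6 - \<gamma>/2 * u0\<^sup>2) * (u1 - u0)
     = p1\<^sup>2 / 2 - p0\<^sup>2 / 2 + (p1 - p0)\<^sup>2 / 2 + (S - \<alpha>) * w\<^sup>2 + r * w"
    by (simp add: w_def r_def power2_eq_square power3_eq_cube field_simps)
  have "A / 2 - D / 2 + (X - W / 2) - R2 / 2 \<le> A / 2 - D / 2 + Y / 2 + X + Z"
    if "- Z \<le> (Q + W) / 2" "0 \<le> Y" "Q \<le> R2" for A D X W R2 Y Z Q :: real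
    using that by (simp add: field_simps)
  from this[OF rw zero_le_power2 rR]
  have "p1\<^sup>2 / 2 - p0\<^sup>2 / 2 + ((S - \<alpha>) * w\<^sup>2 - w\<^sup>2 / 2) - R\<^sup>2 / 2
     \<le> p1\<^sup>2 / 2 - p0\<^sup>2 / 2 + (p1 - p0)\<^sup>2 / 2 + (S - \<alpha>) * w\<^sup>2 + r * w" .
  moreover have "(S - \<alpha> - 1/2) * w\<^sup>2 = (S - \<alpha>) * w\<^sup>2 - w\<^sup>2 / 2"
    by (simp add: algebra_simps)
  ultimately show ?thesis
    unfolding e unfolding w_def[symmetric] R_def[symmetric] by simp
qed

lemma step_dens_upper:
  fixes p0 p1 u0 u1 \<alpha> \<gamma> S N :: real
  assumes u: "\<bar>u0\<bar> \<le> N" "\<bar>u1\<bar> \<le> N" and gam: "0 \<le> \<gamma>" and S: "\<alpha>/2 + N\<^sup>2 / 4 + \<gamma> * N / 2 \<le> S"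
  shows "(1/2 * p1\<^sup>2 - \<alpha>/2 * u1\<^sup>2 + u1^4 / 24 - \<gamma>/6 * u1^3) - (1/2 * p0\<^sup>2 - \<alpha>/2 * u0\<^sup>2 + u0^4 / 24 - \<gamma>/6 * u0^3)
     \<le> p1 * (p1 - p0) - \<alpha> * u1 * (u1 - u0) + S * (u1 - u0)\<^sup>2 + (u0^3 / 6 - \<gamma>/2 * u0\<^sup>2) * (u1 - u0)"
    (is "?l \<le> ?r")
proof -
  define q where "q = (3 * u0\<^sup>2 + 2 * (u0 * u1) + u1\<^sup>2) / 24 - \<gamma> * (2 * u0 + u1) / 6"
  have eq: "?r - ?l = (p1 - p0)\<^sup>2 / 2 + (S - \<alpha>/2 - q) * (u1 - u0)\<^sup>2"
    by (simp add: q_def power2_eq_square power3_eq_cube power4_eq_xxxx field_simps)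
  have sq: "u0\<^sup>2 \<le> N\<^sup>2" "u1\<^sup>2 \<le> N\<^sup>2"
    using power_mono[OF u(1) abs_ge_zero, of 2] power_mono[OF u(2) abs_ge_zero, of 2] by auto
  have "u0 * u1 \<le> N\<^sup>2"
    using sq sum_squares_bound[of u0 u1] by linarith
  then have q1: "(3 * u0\<^sup>2 + 2 * (u0 * u1) + u1\<^sup>2) / 24 \<le> N\<^sup>2 / 4" using sq by simp
  have "- (2 * u0 + u1) \<le> 3 * N" using u by linarith
  then have "\<gamma> * (- (2 * u0 + u1)) \<le> \<gamma> * (3 * N)" using gam by (rule mult_left_mono)
  then have "- (\<gamma> * (2 * u0 + u1) / 6) \<le> \<gamma> * N / 2" by (simp add: field_simps)
  with q1 have "q \<le> N\<^sup>2 / 4 + \<gamma> * N / 2" unfolding q_def by linarith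
  then have "0 \<le> S - \<alpha>/2 - q" using S by linarith
  then have "0 \<le> ?r - ?l" unfolding eq by simp
  then show ?thesis by linarith
qed

lemma scheme_step_estimate:
  fixes L :: "real^'d" and C E0 :: real
  assumes Lpos: "\<forall>i. 0 < L $ i" and gam: "0 \<le> \<gamma>" and alph: "\<alpha> < 1" and S: "S > 0" "\<alpha> + 3/2 \<le> S" and dt: "dt > 0"
    and u0: "u0 \<in> H2per L" and C: "AE x in LM L. \<bar>u0 x\<bar> \<le> C" and E0: "energy L \<alpha> \<gamma> u0 \<le> E0"
    and sch: "scheme_step L \<alpha> \<gamma> S dt u0 u1"
  defines "b1 \<equiv> E0 + (\<bar>\<alpha>\<bar>/2 * C\<^sup>2 + \<gamma>/6 * C^3 + (\<bar>\<alpha>\<bar> * C + C^3 / 6 + \<gamma>/2 * C\<^sup>2)\<^sup>2 / 2) * vol L"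
  shows "intO L (\<lambda>x. (u1 x)\<^sup>2) \<le> 2 * b1 + 2 * C\<^sup>2 * vol L" "intO L (\<lambda>x. (lap L u1 x + u1 x)\<^sup>2) \<le> 2 * b1"
proof -
  have u1: "u1 \<in> H2per L" using sch by (simp add: scheme_step_def)
  define p0 where "p0 x = lap L u0 x + u0 x" for x
  define p1 where "p1 x = lap L u1 x + u1 x" for x
  define w where "w x = u1 x - u0 x" for x
  define R where "R = \<bar>\<alpha>\<bar> * C + C^3 / 6 + \<gamma>/2 * C\<^sup>2"
  have L2: "L2on L p0" "L2on L p1" "L2on L w" "L2on L u0" "L2on L u1"
    unfolding p0_def[abs_def] p1_def[abs_def] w_def[abs_def] by (intro L2on_add L2on_diff L2on_lap H2perD(2) u0 u1)+
  note i = L2onD(2)[OF L2(1)] L2onD(2)[OF L2(2)] L2onD(2)[OF L2(3)] L2onD(2)[OF L2(4)] L2onD(2)[OF L2(5)]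
  note ic = finite_measure.integrable_const[OF finite_measure_LM[of L]]
  have nn: "0 \<le> intO L (\<lambda>x. (w x)\<^sup>2)" "0 \<le> intO L (\<lambda>x. (p1 x)\<^sup>2)" by (simp_all add: intO_def)
  have low: "intO L (\<lambda>x. (p1 x)\<^sup>2 / 2 - (p0 x)\<^sup>2 / 2 + (S - \<alpha> - 1/2) * (w x)\<^sup>2 - R\<^sup>2 / 2) \<le> intO L (step_dens L \<alpha> \<gamma> S u0 u1)"
  proof (rule intO_mono_AE)
    show "integrable (LM L) (\<lambda>x. (p1 x)\<^sup>2 / 2 - (p0 x)\<^sup>2 / 2 + (S - \<alpha> - 1/2) * (w x)\<^sup>2 - R\<^sup>2 / 2)"
      by (intro Bochner_Integration.integrable_diff[OF _ ic] Bochner_Integration.integrable_add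
          Bochner_Integration.integrable_diff integrable_divide integrable_mult_right i)
    show "integrable (LM L) (step_dens L \<alpha> \<gamma> S u0 u1)"
      by (rule scheme_identity(1)[OF Lpos alph S(1) dt u0 C sch])
    show "AE x in LM L. (p1 x)\<^sup>2 / 2 - (p0 x)\<^sup>2 / 2 + (S - \<alpha> - 1/2) * (w x)\<^sup>2 - R\<^sup>2 / 2 \<le> step_dens L \<alpha> \<gamma> S u0 u1 x"
      using C by eventually_elim
        (use step_dens_lower[OF _ gam] in \<open>simp add: step_dens_def p0_def p1_def w_def R_def\<close>)
  qed
  also have "\<dots> \<le> 0" by (rule scheme_identity(2)[OF Lpos alph S(1) dt u0 C sch])
  finally have I0: "intO L (\<lambda>x. (p1 x)\<^sup>2 / 2 - (p0 x)\<^sup>2 / 2 + (S - \<alpha> - 1/2) * (w x)\<^sup>2 - R\<^sup>2 / 2) \<le> 0" .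
  have 1: "intO L (\<lambda>x. (p1 x)\<^sup>2) / 2 - intO L (\<lambda>x. (p0 x)\<^sup>2) / 2 + (S - \<alpha> - 1/2) * intO L (\<lambda>x. (w x)\<^sup>2)
      - R\<^sup>2 / 2 * vol L \<le> 0"
  proof -
    have "integrable (LM L) (\<lambda>x. (p1 x)\<^sup>2 / 2 - (p0 x)\<^sup>2 / 2 + (S - \<alpha> - 1/2) * (w x)\<^sup>2)" using i by simp
    from Bochner_Integration.integral_diff[OF this ic, of "R\<^sup>2 / 2"] I0 show ?thesis
      unfolding intO_const[of L "R\<^sup>2 / 2", unfolded intO_def] using i by (simp add: intO_def)
  qed
  have "1 * intO L (\<lambda>x. (w x)\<^sup>2) \<le> (S - \<alpha> - 1/2) * intO L (\<lambda>x. (w x)\<^sup>2)"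
    using S(2) nn by (intro mult_right_mono) auto
  with 1 have 2: "intO L (\<lambda>x. (p1 x)\<^sup>2) / 2 + intO L (\<lambda>x. (w x)\<^sup>2) \<le> intO L (\<lambda>x. (p0 x)\<^sup>2) / 2 + R\<^sup>2 / 2 * vol L"
    by simp
  have u0sq: "intO L (\<lambda>x. (u0 x)\<^sup>2) \<le> C\<^sup>2 * vol L"
  proof -
    have "intO L (\<lambda>x. (u0 x)\<^sup>2) \<le> intO L (\<lambda>x. C\<^sup>2)"
    proof (rule intO_mono_AE[OF i(4) ic])
      show "AE x in LM L. (u0 x)\<^sup>2 \<le> C\<^sup>2"
        using C by eventually_elim (metis abs_ge_zero power2_abs power_mono)
    qed
    then show ?thesis by simp
  qed
  have 3: "intO L (\<lambda>x. (p0 x)\<^sup>2) / 2 \<le> E0 + \<bar>\<alpha>\<bar>/2 * (C\<^sup>2 * vol L) + \<gamma>/6 * C^3 * vol L"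
  proof -
    note m0 = L2onD(1)[OF H2perD(2)[OF u0]]
    have "intO L (\<lambda>x. - (\<gamma>/6 * C^3)) \<le> intO L (\<lambda>x. (u0 x)^4 / 24 - \<gamma>/6 * (u0 x)^3)"
    proof (rule intO_mono_AE[OF ic])
      show "integrable (LM L) (\<lambda>x. (u0 x)^4 / 24 - \<gamma>/6 * (u0 x)^3)"
        using integrable_power_bounded[OF m0 C, of 4] integrable_power_bounded[OF m0 C, of 3] by simp
      show "AE x in LM L. - (\<gamma>/6 * C^3) \<le> (u0 x)^4 / 24 - \<gamma>/6 * (u0 x)^3"
        using C
      proof eventually_elim
        case (elim x)
        have "(u0 x)^3 \<le> \<bar>u0 x\<bar>^3" by (metis abs_ge_self power_abs)
        also have "\<dots> \<le> C^3" using elim by (intro power_mono) auto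
        finally have "\<gamma>/6 * (u0 x)^3 \<le> \<gamma>/6 * C^3" using gam by (intro mult_left_mono) auto
        moreover have "0 \<le> (u0 x)^4 / 24" by simp
        ultimately show ?case by linarith
      qed
    qed
    moreover have "\<alpha>/2 * intO L (\<lambda>x. (u0 x)\<^sup>2) \<le> \<bar>\<alpha>\<bar>/2 * (C\<^sup>2 * vol L)"
      using u0sq by (intro mult_mono) (auto simp: intO_def)
    moreover have "- (\<gamma>/6 * C^3) * vol L = - (\<gamma>/6 * C^3 * vol L)" by simp
    ultimately show ?thesis
      using E0 unfolding energy_bounded(2)[OF u0 C] p0_def intO_const by linarith
  qed
  have b1: "intO L (\<lambda>x. (p1 x)\<^sup>2) / 2 + intO L (\<lambda>x. (w x)\<^sup>2) \<le> b1"
    using 2 3 unfolding b1_def R_def[symmetric] by (simp add: algebra_simps)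
  then show "intO L (\<lambda>x. (lap L u1 x + u1 x)\<^sup>2) \<le> 2 * b1"
    using nn unfolding p1_def by linarith
  have "intO L (\<lambda>x. (u1 x)\<^sup>2) \<le> intO L (\<lambda>x. 2 * (w x)\<^sup>2 + 2 * (u0 x)\<^sup>2)"
  proof (rule intO_mono_AE[OF i(5)])
    show "integrable (LM L) (\<lambda>x. 2 * (w x)\<^sup>2 + 2 * (u0 x)\<^sup>2)" using i by simp
    have "(u1 x)\<^sup>2 \<le> 2 * (w x)\<^sup>2 + 2 * (u0 x)\<^sup>2" for x
    proof -
      have "0 \<le> (w x - u0 x)\<^sup>2" by simp
      then show ?thesis by (simp add: w_def power2_eq_square algebra_simps)
    qed
    then show "AE x in LM L. (u1 x)\<^sup>2 \<le> 2 * (w x)\<^sup>2 + 2 * (u0 x)\<^sup>2" by simp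
  qed
  also have "\<dots> = 2 * intO L (\<lambda>x. (w x)\<^sup>2) + 2 * intO L (\<lambda>x. (u0 x)\<^sup>2)"
    by (rule intO_linear[OF i(3,4)])
  also have "\<dots> \<le> 2 * b1 + 2 * C\<^sup>2 * vol L"
    using b1 nn u0sq by (simp add: mult.assoc)
  finally show "intO L (\<lambda>x. (u1 x)\<^sup>2) \<le> 2 * b1 + 2 * C\<^sup>2 * vol L" .
qed

lemma scheme_energy_decay:
  fixes L :: "real^'d"
  assumes Lpos: "\<forall>i. 0 < L $ i" and gam: "0 \<le> \<gamma>" and alph: "\<alpha> < 1" and S: "S > 0" "\<alpha>/2 + N\<^sup>2 / 4 + \<gamma> * N / 2 \<le> S"
    and dt: "dt > 0" and u0: "u0 \<in> H2per L" and N: "AE x in LM L. \<bar>u0 x\<bar> \<le> N" "AE x in LM L. \<bar>u1 x\<bar> \<le> N"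
    and sch: "scheme_step L \<alpha> \<gamma> S dt u0 u1"
  shows "energy L \<alpha> \<gamma> u1 \<le> energy L \<alpha> \<gamma> u0"
proof -
  have u1: "u1 \<in> H2per L" using sch by (simp add: scheme_step_def)
  have fe: "integrable (LM L) (edens L \<alpha> \<gamma> u1)" "integrable (LM L) (edens L \<alpha> \<gamma> u0)"
    using energy_bounded(1)[OF u1 N(2)] energy_bounded(1)[OF u0 N(1)] by (simp_all add: finite_energy_def)
  have "energy L \<alpha> \<gamma> u1 - energy L \<alpha> \<gamma> u0 = intO L (\<lambda>x. edens L \<alpha> \<gamma> u1 x - edens L \<alpha> \<gamma> u0 x)"
    using fe by (simp add: energy_def intO_def)
  also have "\<dots> \<le> intO L (step_dens L \<alpha> \<gamma> S u0 u1)"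
  proof (rule intO_mono_AE)
    show "integrable (LM L) (\<lambda>x. edens L \<alpha> \<gamma> u1 x - edens L \<alpha> \<gamma> u0 x)" using fe by simp
    show "integrable (LM L) (step_dens L \<alpha> \<gamma> S u0 u1)"
      by (rule scheme_identity(1)[OF Lpos alph S(1) dt u0 N(1) sch])
    show "AE x in LM L. edens L \<alpha> \<gamma> u1 x - edens L \<alpha> \<gamma> u0 x \<le> step_dens L \<alpha> \<gamma> S u0 u1 x"
      using N
    proof eventually_elim
      case (elim x)
      show ?case unfolding edens_def step_dens_def by (rule step_dens_upper[OF elim gam S(2)])
    qed
  qed
  also have "\<dots> \<le> 0" by (rule scheme_identity(2)[OF Lpos alph S(1) dt u0 N(1) sch])
  finally show ?thesis by simp
qed

theorem theorem2p1:
  fixes L :: "real^'d" and \<alpha> \<gamma> lam :: real and \<phi>0 :: "real^'d \<Rightarrow> real"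
  assumes dim: "CARD('d) \<le> 3"
    and Lpos: "\<forall>i. 0 < L $ i"
    and gam: "\<gamma> \<ge> 0" and alph: "\<alpha> < 1"
    and lam: "lam > 0"
    and lam_bound: "\<forall>\<psi>\<in>H2per L. finite_energy L \<alpha> \<gamma> \<psi> \<longrightarrow>
        supabs L \<psi> \<le> ereal (sqrt ((energy L \<alpha> \<gamma> \<psi> + (9 * \<gamma>^4 + 3) * vol L) / lam))"
    and init: "\<phi>0 \<in> H2per L" "finite_energy L \<alpha> \<gamma> \<phi>0"
  shows "\<exists>S>0. \<forall>dt>0. \<forall>\<phi> :: nat \<Rightarrow> real^'d \<Rightarrow> real.
           \<phi> 0 = \<phi>0 \<and> (\<forall>n. scheme_step L \<alpha> \<gamma> S dt (\<phi> n) (\<phi> (Suc n))) \<longrightarrow>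
           (\<forall>n. supabs L (\<phi> n)
                  \<le> ereal (sqrt ((energy L \<alpha> \<gamma> \<phi>0 + (9 * \<gamma>^4 + 3) * vol L) / lam))
                \<and> energy L \<alpha> \<gamma> (\<phi> (Suc n)) \<le> energy L \<alpha> \<gamma> (\<phi> n))"
proof -
  define c where "c = (9 * \<gamma>^4 + 3) * vol L"
  define E0 where "E0 = energy L \<alpha> \<gamma> \<phi>0"
  define C where "C = sqrt ((E0 + c) / lam)"
  define b1 where "b1 = E0 + (\<bar>\<alpha>\<bar>/2 * C\<^sup>2 + \<gamma>/6 * C^3 + (\<bar>\<alpha>\<bar> * C + C^3 / 6 + \<gamma>/2 * C\<^sup>2)\<^sup>2 / 2) * vol L"
  define M where "M = sup_bound \<alpha> \<gamma> lam c (2 * b1 + 2 * C\<^sup>2 * vol L) (2 * b1)"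
  define N where "N = max 0 (max C M)"
  define S where "S = \<bar>\<alpha>\<bar> + 3/2 + N\<^sup>2 / 4 + \<gamma> * N / 2"
  have c: "0 \<le> c" using vol_pos[OF Lpos] by (simp add: c_def)
  note lb = lam_bound[folded c_def]
  have N0: "0 \<le> N" and gN: "0 \<le> \<gamma> * N" using gam by (simp_all add: N_def)
  have S: "0 < S" "\<alpha> + 3/2 \<le> S" "\<alpha>/2 + N\<^sup>2 / 4 + \<gamma> * N / 2 \<le> S"
    using gN zero_le_power2[of N] unfolding S_def by linarith+
  have sup: "supabs L u \<le> ereal C"
    if "u \<in> H2per L" "finite_energy L \<alpha> \<gamma> u" "energy L \<alpha> \<gamma> u \<le> E0" for u
  proof -
    have "supabs L u \<le> ereal (sqrt ((energy L \<alpha> \<gamma> u + c) / lam))" using lb that by blast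
    also have "\<dots> \<le> ereal C"
      unfolding C_def ereal_less_eq using that(3) lam by (intro real_sqrt_le_mono divide_right_mono) auto
    finally show ?thesis .
  qed
  show ?thesis
  proof (intro exI[of _ S] conjI S(1) allI impI)
    fix dt :: real and \<phi> :: "nat \<Rightarrow> real^'d \<Rightarrow> real"
    assume dt: "0 < dt" and "\<phi> 0 = \<phi>0 \<and> (\<forall>n. scheme_step L \<alpha> \<gamma> S dt (\<phi> n) (\<phi> (Suc n)))"
    then have p0: "\<phi> 0 = \<phi>0" and sch: "\<And>n. scheme_step L \<alpha> \<gamma> S dt (\<phi> n) (\<phi> (Suc n))" by auto
    have step: "finite_energy L \<alpha> \<gamma> u1 \<and> energy L \<alpha> \<gamma> u1 \<le> energy L \<alpha> \<gamma> u0"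
      if u0: "u0 \<in> H2per L" "finite_energy L \<alpha> \<gamma> u0" "energy L \<alpha> \<gamma> u0 \<le> E0" and s: "scheme_step L \<alpha> \<gamma> S dt u0 u1"
      for u0 u1
    proof -
      have u1: "u1 \<in> H2per L" using s by (simp add: scheme_step_def)
      have A0: "AE x in LM L. \<bar>u0 x\<bar> \<le> C" by (rule supabs_le_imp_AE[OF sup[OF u0]])
      note est = scheme_step_estimate[OF Lpos gam alph S(1,2) dt u0(1) A0 u0(3) s, folded b1_def]
      have A1: "AE x in LM L. \<bar>u1 x\<bar> \<le> M"
        unfolding M_def by (rule sup_bound_H2per[OF Lpos gam lam c lb u1 est])
      have N: "AE x in LM L. \<bar>u0 x\<bar> \<le> N" "AE x in LM L. \<bar>u1 x\<bar> \<le> N"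
        using A0 A1 by (eventually_elim; simp add: N_def)+
      show ?thesis
        using energy_bounded(1)[OF u1 N(2)] scheme_energy_decay[OF Lpos gam alph S(1,3) dt u0(1) N s] by blast
    qed
    have inv: "\<phi> n \<in> H2per L \<and> finite_energy L \<alpha> \<gamma> (\<phi> n) \<and> energy L \<alpha> \<gamma> (\<phi> n) \<le> E0" for n
    proof (induction n)
      case 0
      then show ?case using init by (simp add: p0 E0_def)
    next
      case (Suc n)
      have "\<phi> (Suc n) \<in> H2per L" using sch[of n] by (simp add: scheme_step_def)
      then show ?case using step[OF _ _ _ sch[of n]] Suc by force
    qed
    fix n
    show "supabs L (\<phi> n) \<le> ereal (sqrt ((energy L \<alpha> \<gamma> \<phi>0 + (9 * \<gamma>^4 + 3) * vol L) / lam))"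
      using sup[of "\<phi> n"] inv[of n] by (simp add: C_def E0_def c_def)
    show "energy L \<alpha> \<gamma> (\<phi> (Suc n)) \<le> energy L \<alpha> \<gamma> (\<phi> n)"
      using step[OF _ _ _ sch[of n]] inv[of n] by blast
  qed
qed

end
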